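(* Let $M$ be a monoid, $\Gamma, C : \mathbf{PSh}(M) \to \mathbf{Set}$ the global sections and connected components functors, and $\alpha : \Gamma \to C$ the canonical natural transformation. The following are equivalent: (1) $M$ has a zero element. (2) $\Gamma$ is full. (3) $\alpha$ is a split monomorphism. (4) $\alpha$ is an isomorphism; that is, $\mathbf{PSh}(M)$ is bipunctually locally connected. (5) $\Gamma$ has a right adjoint and $C$ has a left adjoint; that is, $\mathbf{PSh}(M)$ is bilocal. (6) $\alpha$ is epic and $C$ preserves $\mathbf{Set}$-indexed powers. (7) $\Gamma$ has a right adjoint and $C$ preserves monomorphisms. (8) $C$ has a left adjoint which preserves the terminal object of $\mathbf{Set}$.
   Context: For a monoid $M$, $\mathbf{PSh}(M)$ denotes the category of right $M$-sets (the empty one included) and $M$-equivariant maps. $\Delta : \mathbf{Set} \to \mathbf{PSh}(M)$ equips a set with the trivial action. Its right adjoint $\Gamma$ sends $X$ to the set of fixed points $\{x \in X : xm = x \ \forall m \in M\}$; its left adjoint $C$ sends $X$ to the quotient of $X$ by the equivalence relation generated by $x \sim xm$ ($x\in X$, $m \in M$). The natural transformation $\alpha : \Gamma \to C$ sends a fixed point of $X$ to the connected component of $X$ containing it. A zero element of $M$ is an element $z$ with $zn = z = nz$ for all $n \in M$. $\mathbf{PSh}(M)$ is punctually (resp. copunctually) locally connected if $\alpha$ is epic (resp. monic), and bipunctually locally connected if both hold; it is local if $\Gamma$ has a right adjoint, colocal if $C$ has a left adjoint, and bilocal if both hold. For a set $I$ and a right $M$-set $Y$, the exponential $Y^{\Delta(I)}$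 in $\mathbf{PSh}(M)$ is the set of functions $I \to Y$ with pointwise action; $C$ preserves $\mathbf{Set}$-indexed powers if the canonical map $C(Y^{\Delta(I)}) \to C(Y)^{I}$, $[(y_i)_{i\in I}] \mapsto ([y_i])_{i \in I}$, is an isomorphism for all sets $I$ and all right $M$-sets $Y$. *)

theory Defs
  imports "HOL-Algebra.Group"
begin

subsection \<open>Categories\<close>

text \<open>
  Composition takes the three objects involved as extra arguments, so hom-sets need not be
  disjoint: \<open>Comp \<C> X Y Z g f\<close> is the composite of \<open>f : X \<rightarrow> Y\<close> followed by \<open>g : Y \<rightarrow> Z\<close>.
  For the same reason the arrow part of a functor takes domain and codomain as arguments.
\<close>

record ('o, 'a) cat =
  Obj :: "'o set"
  Hom :: "'o \<Rightarrow> 'o \<Rightarrow> 'a set"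
  Ident :: "'o \<Rightarrow> 'a"
  Comp :: "'o \<Rightarrow> 'o \<Rightarrow> 'o \<Rightarrow> 'a \<Rightarrow> 'a \<Rightarrow> 'a"

definition is_category :: "('o, 'a) cat \<Rightarrow> bool" where
  "is_category \<C> \<longleftrightarrow>
     (\<forall>X\<in>Obj \<C>. Ident \<C> X \<in> Hom \<C> X X) \<and>
     (\<forall>X\<in>Obj \<C>. \<forall>Y\<in>Obj \<C>. \<forall>Z\<in>Obj \<C>. \<forall>f\<in>Hom \<C> X Y. \<forall>g\<in>Hom \<C> Y Z.
        Comp \<C> X Y Z g f \<in> Hom \<C> X Z) \<and>
     (\<forall>X\<in>Obj \<C>. \<forall>Y\<in>Obj \<C>. \<forall>f\<in>Hom \<C> X Y.
        Comp \<C> X X Y f (Ident \<C> X) = f \<and> Comp \<C> X Y Y (Ident \<C> Y) f = f) \<and>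
     (\<forall>W\<in>Obj \<C>. \<forall>X\<in>Obj \<C>. \<forall>Y\<in>Obj \<C>. \<forall>Z\<in>Obj \<C>.
        \<forall>f\<in>Hom \<C> W X. \<forall>g\<in>Hom \<C> X Y. \<forall>h\<in>Hom \<C> Y Z.
          Comp \<C> W Y Z h (Comp \<C> W X Y g f) = Comp \<C> W X Z (Comp \<C> X Y Z h g) f)"

definition monic :: "('o, 'a) cat \<Rightarrow> 'o \<Rightarrow> 'o \<Rightarrow> 'a \<Rightarrow> bool" where
  "monic \<C> X Y f \<longleftrightarrow> X \<in> Obj \<C> \<and> Y \<in> Obj \<C> \<and> f \<in> Hom \<C> X Y \<and>
     (\<forall>W\<in>Obj \<C>. \<forall>g\<in>Hom \<C> W X. \<forall>h\<in>Hom \<C> W X.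
        Comp \<C> W X Y f g = Comp \<C> W X Y f h \<longrightarrow> g = h)"

definition epic :: "('o, 'a) cat \<Rightarrow> 'o \<Rightarrow> 'o \<Rightarrow> 'a \<Rightarrow> bool" where
  "epic \<C> X Y f \<longleftrightarrow> X \<in> Obj \<C> \<and> Y \<in> Obj \<C> \<and> f \<in> Hom \<C> X Y \<and>
     (\<forall>Z\<in>Obj \<C>. \<forall>g\<in>Hom \<C> Y Z. \<forall>h\<in>Hom \<C> Y Z.
        Comp \<C> X Y Z g f = Comp \<C> X Y Z h f \<longrightarrow> g = h)"

definition split_monic :: "('o, 'a) cat \<Rightarrow> 'o \<Rightarrow> 'o \<Rightarrow> 'a \<Rightarrow> bool" where
  "split_monic \<C> X Y f \<longleftrightarrow> X \<in> Obj \<C> \<and> Y \<in> Obj \<C> \<and> f \<in> Hom \<C> X Y \<and>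
     (\<exists>r\<in>Hom \<C> Y X. Comp \<C> X Y X r f = Ident \<C> X)"

definition isomorphism :: "('o, 'a) cat \<Rightarrow> 'o \<Rightarrow> 'o \<Rightarrow> 'a \<Rightarrow> bool" where
  "isomorphism \<C> X Y f \<longleftrightarrow> X \<in> Obj \<C> \<and> Y \<in> Obj \<C> \<and> f \<in> Hom \<C> X Y \<and>
     (\<exists>g\<in>Hom \<C> Y X. Comp \<C> X Y X g f = Ident \<C> X \<and> Comp \<C> Y X Y f g = Ident \<C> Y)"

definition terminal :: "('o, 'a) cat \<Rightarrow> 'o \<Rightarrow> bool" where
  "terminal \<C> T \<longleftrightarrow> T \<in> Obj \<C> \<and> (\<forall>X\<in>Obj \<C>. \<exists>!f. f \<in> Hom \<C> X T)"


subsection \<open>Functors, natural transformations and adjunctions\<close>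

record ('o, 'a, 'p, 'b) functr =
  fobj :: "'o \<Rightarrow> 'p"
  fmap :: "'o \<Rightarrow> 'o \<Rightarrow> 'a \<Rightarrow> 'b"

definition is_functor ::
    "('o, 'a) cat \<Rightarrow> ('p, 'b) cat \<Rightarrow> ('o, 'a, 'p, 'b) functr \<Rightarrow> bool" where
  "is_functor \<A> \<B> F \<longleftrightarrow>
     (\<forall>X\<in>Obj \<A>. fobj F X \<in> Obj \<B>) \<and>
     (\<forall>X\<in>Obj \<A>. \<forall>Y\<in>Obj \<A>. \<forall>f\<in>Hom \<A> X Y. fmap F X Y f \<in> Hom \<B> (fobj F X) (fobj F Y)) \<and>
     (\<forall>X\<in>Obj \<A>. fmap F X X (Ident \<A> X) = Ident \<B> (fobj F X)) \<and>
     (\<forall>X\<in>Obj \<A>. \<forall>Y\<in>Obj \<A>. \<forall>Z\<in>Obj \<A>. \<forall>f\<in>Hom \<A> X Y. \<forall>g\<in>Hom \<A> Y Z.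
        fmap F X Z (Comp \<A> X Y Z g f) =
          Comp \<B> (fobj F X) (fobj F Y) (fobj F Z) (fmap F Y Z g) (fmap F X Y f))"

definition natural ::
    "('o, 'a) cat \<Rightarrow> ('p, 'b) cat \<Rightarrow> ('o, 'a, 'p, 'b) functr \<Rightarrow> ('o, 'a, 'p, 'b) functr
      \<Rightarrow> ('o \<Rightarrow> 'b) \<Rightarrow> bool" where
  "natural \<A> \<B> F G \<eta> \<longleftrightarrow>
     (\<forall>X\<in>Obj \<A>. \<eta> X \<in> Hom \<B> (fobj F X) (fobj G X)) \<and>
     (\<forall>X\<in>Obj \<A>. \<forall>Y\<in>Obj \<A>. \<forall>f\<in>Hom \<A> X Y.
        Comp \<B> (fobj F X) (fobj F Y) (fobj G Y) (\<eta> Y) (fmap F X Y f) =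
        Comp \<B> (fobj F X) (fobj G X) (fobj G Y) (fmap G X Y f) (\<eta> X))"

text \<open>Families of arrows are \<open>extensional\<close>, so that equality of natural transformations is
  equality of their components at the objects of the domain category.\<close>

definition functor_cat ::
    "('o, 'a) cat \<Rightarrow> ('p, 'b) cat \<Rightarrow> (('o, 'a, 'p, 'b) functr, 'o \<Rightarrow> 'b) cat" where
  "functor_cat \<A> \<B> =
     \<lparr> Obj = {F. is_functor \<A> \<B> F},
       Hom = (\<lambda>F G. {\<eta> \<in> extensional (Obj \<A>). natural \<A> \<B> F G \<eta>}),
       Ident = (\<lambda>F. \<lambda>X\<in>Obj \<A>. Ident \<B> (fobj F X)),
       Comp = (\<lambda>F G H \<theta> \<eta>. \<lambda>X\<in>Obj \<A>. Comp \<B> (fobj F X) (fobj G X) (fobj H X) (\<theta> X) (\<eta> X)) \<rparr>"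

definition full :: "('o, 'a) cat \<Rightarrow> ('p, 'b) cat \<Rightarrow> ('o, 'a, 'p, 'b) functr \<Rightarrow> bool" where
  "full \<A> \<B> F \<longleftrightarrow> is_functor \<A> \<B> F \<and>
     (\<forall>X\<in>Obj \<A>. \<forall>Y\<in>Obj \<A>. \<forall>g\<in>Hom \<B> (fobj F X) (fobj F Y). \<exists>f\<in>Hom \<A> X Y. fmap F X Y f = g)"

definition preserves_monos ::
    "('o, 'a) cat \<Rightarrow> ('p, 'b) cat \<Rightarrow> ('o, 'a, 'p, 'b) functr \<Rightarrow> bool" where
  "preserves_monos \<A> \<B> F \<longleftrightarrow>
     (\<forall>X Y f. monic \<A> X Y f \<longrightarrow> monic \<B> (fobj F X) (fobj F Y) (fmap F X Y f))"

definition preserves_terminal ::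
    "('o, 'a) cat \<Rightarrow> ('p, 'b) cat \<Rightarrow> ('o, 'a, 'p, 'b) functr \<Rightarrow> bool" where
  "preserves_terminal \<A> \<B> F \<longleftrightarrow> (\<forall>T. terminal \<A> T \<longrightarrow> terminal \<B> (fobj F T))"

text \<open>\<open>adjoint \<A> \<B> L R\<close>: the functor \<open>L : \<A> \<rightarrow> \<B>\<close> is left adjoint to \<open>R : \<B> \<rightarrow> \<A>\<close>.\<close>

definition adjoint ::
    "('o, 'a) cat \<Rightarrow> ('p, 'b) cat \<Rightarrow> ('o, 'a, 'p, 'b) functr \<Rightarrow> ('p, 'b, 'o, 'a) functr \<Rightarrow> bool"
  where
  "adjoint \<A> \<B> L R \<longleftrightarrow> is_functor \<A> \<B> L \<and> is_functor \<B> \<A> R \<and>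
     (\<exists>\<phi>. (\<forall>X\<in>Obj \<A>. \<forall>Y\<in>Obj \<B>. bij_betw (\<phi> X Y) (Hom \<B> (fobj L X) Y) (Hom \<A> X (fobj R Y))) \<and>
          (\<forall>X\<in>Obj \<A>. \<forall>X'\<in>Obj \<A>. \<forall>Y\<in>Obj \<B>. \<forall>Y'\<in>Obj \<B>.
             \<forall>h\<in>Hom \<A> X' X. \<forall>k\<in>Hom \<B> Y Y'. \<forall>f\<in>Hom \<B> (fobj L X) Y.
               \<phi> X' Y' (Comp \<B> (fobj L X') Y Y' k
                          (Comp \<B> (fobj L X') (fobj L X) Y f (fmap L X' X h))) =
               Comp \<A> X' (fobj R Y) (fobj R Y') (fmap R Y Y' k)
                 (Comp \<A> X' X (fobj R Y) (\<phi> X Y f) h)))"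


subsection \<open>The category of small sets\<close>

text \<open>
  A universe is a collection \<open>S\<close> of sets (the small ones) over some type, satisfying infinity,
  separation, replacement and union.  Every Grothendieck universe that contains an infinite set
  is an instance, as is the class of all small sets over a type of all ZFC sets.  Power sets are
  deliberately not required: given infinity, closure under them forces the type to have at least inaccessible
  cardinality, and Isabelle/HOL does not prove that such a type exists.  Without this requirement,
  the collection of all subsets of any infinite type is an instance, too.
\<close>

definition set_universe :: "'u set set \<Rightarrow> bool" where
  "set_universe S \<longleftrightarrow>
     (\<exists>A\<in>S. infinite A) \<and>
     (\<forall>A\<in>S. \<forall>B. B \<subseteq> A \<longrightarrow> B \<in> S) \<and>
     (\<forall>A\<in>S. \<forall>f. f ` A \<in> S) \<and>
     (\<forall>A\<in>S. \<forall>B. (\<forall>a\<in>A. B a \<in> S) \<longrightarrow> (\<Union>a\<in>A. B a) \<in> S)"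

definition SET :: "'u set set \<Rightarrow> ('u set, 'u \<Rightarrow> 'u) cat" where
  "SET S =
     \<lparr> Obj = S,
       Hom = (\<lambda>A B. A \<rightarrow>\<^sub>E B),
       Ident = (\<lambda>A. \<lambda>x\<in>A. x),
       Comp = (\<lambda>A B C g f. compose A g f) \<rparr>"


subsection \<open>Right \<open>M\<close>-sets\<close>

record ('x, 'm) rset =
  pts :: "'x set"
  act :: "'x \<Rightarrow> 'm \<Rightarrow> 'x"

definition right_mset :: "('m, 'z) monoid_scheme \<Rightarrow> ('x, 'm) rset \<Rightarrow> bool" where
  "right_mset M X \<longleftrightarrow>
     (\<forall>x\<in>pts X. \<forall>m\<in>carrier M. act X x m \<in> pts X) \<and>
     (\<forall>x\<in>pts X. act X x \<one>\<^bsub>M\<^esub> = x) \<and>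
     (\<forall>x\<in>pts X. \<forall>m\<in>carrier M. \<forall>n\<in>carrier M. act X x (m \<otimes>\<^bsub>M\<^esub> n) = act X (act X x m) n)"

definition equivariant ::
    "('m, 'z) monoid_scheme \<Rightarrow> ('x, 'm) rset \<Rightarrow> ('y, 'm) rset \<Rightarrow> ('x \<Rightarrow> 'y) set" where
  "equivariant M X Y =
     {f \<in> pts X \<rightarrow>\<^sub>E pts Y. \<forall>x\<in>pts X. \<forall>m\<in>carrier M. f (act X x m) = act Y (f x) m}"

definition PSh ::
    "'u set set \<Rightarrow> ('m, 'z) monoid_scheme \<Rightarrow> (('u, 'm) rset, 'u \<Rightarrow> 'u) cat" where
  "PSh S M =
     \<lparr> Obj = {X. right_mset M X \<and> pts X \<in> S},
       Hom = equivariant M,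
       Ident = (\<lambda>X. \<lambda>x\<in>pts X. x),
       Comp = (\<lambda>X Y Z g f. compose (pts X) g f) \<rparr>"

definition fixed_points :: "('m, 'z) monoid_scheme \<Rightarrow> ('x, 'm) rset \<Rightarrow> 'x set" where
  "fixed_points M X = {x \<in> pts X. \<forall>m\<in>carrier M. act X x m = x}"

definition conn :: "('m, 'z) monoid_scheme \<Rightarrow> ('x, 'm) rset \<Rightarrow> ('x \<times> 'x) set" where
  "conn M X =
     \<Inter>{R. equiv (pts X) R \<and> (\<forall>x\<in>pts X. \<forall>m\<in>carrier M. (x, act X x m) \<in> R)}"

text \<open>
  A connected component is a \<^emph>\<open>set\<close> of points, but the functor of connected components has to land
  in sets over the type of points itself.  The quotient of \<open>pts X\<close> by \<open>conn M X\<close> is therefore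
  realised by one chosen representative per class, with quotient map \<open>cls M X\<close>.
\<close>

definition cls :: "('m, 'z) monoid_scheme \<Rightarrow> ('x, 'm) rset \<Rightarrow> 'x \<Rightarrow> 'x" where
  "cls M X x = (SOME y. y \<in> conn M X `` {x})"

definition components :: "('m, 'z) monoid_scheme \<Rightarrow> ('x, 'm) rset \<Rightarrow> 'x set" where
  "components M X = cls M X ` pts X"

text \<open>The exponential \<open>Y\<^sup>\<Delta>\<^sup>(\<^sup>I\<^sup>)\<close>.\<close>

definition power_rset :: "'i set \<Rightarrow> ('x, 'm) rset \<Rightarrow> ('i \<Rightarrow> 'x, 'm) rset" where
  "power_rset I Y = \<lparr> pts = I \<rightarrow>\<^sub>E pts Y, act = (\<lambda>y m. \<lambda>i\<in>I. act Y (y i) m) \<rparr>"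


subsection \<open>The functors \<open>\<Delta>\<close>, \<open>\<Gamma>\<close>, \<open>C\<close> and the transformation \<open>\<alpha>\<close>\<close>

definition Delta_fun :: "('u set, 'u \<Rightarrow> 'u, ('u, 'm) rset, 'u \<Rightarrow> 'u) functr" where
  "Delta_fun = \<lparr> fobj = (\<lambda>A. \<lparr> pts = A, act = (\<lambda>x m. x) \<rparr>), fmap = (\<lambda>A B f. f) \<rparr>"

definition Gamma_fun ::
    "('m, 'z) monoid_scheme \<Rightarrow> (('u, 'm) rset, 'u \<Rightarrow> 'u, 'u set, 'u \<Rightarrow> 'u) functr" where
  "Gamma_fun M = \<lparr> fobj = fixed_points M, fmap = (\<lambda>X Y f. restrict f (fixed_points M X)) \<rparr>"

definition C_fun ::
    "('m, 'z) monoid_scheme \<Rightarrow> (('u, 'm) rset, 'u \<Rightarrow> 'u, 'u set, 'u \<Rightarrow> 'u) functr" where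
  "C_fun M = \<lparr> fobj = components M, fmap = (\<lambda>X Y f. \<lambda>c\<in>components M X. cls M Y (f c)) \<rparr>"

definition alpha ::
    "'u set set \<Rightarrow> ('m, 'z) monoid_scheme \<Rightarrow> ('u, 'm) rset \<Rightarrow> 'u \<Rightarrow> 'u" where
  "alpha S M = (\<lambda>X\<in>Obj (PSh S M). \<lambda>x\<in>fixed_points M X. cls M X x)"


subsection \<open>Properties of \<open>PSh(M)\<close>\<close>

definition has_zero :: "('m, 'z) monoid_scheme \<Rightarrow> bool" where
  "has_zero M \<longleftrightarrow> (\<exists>z\<in>carrier M. \<forall>n\<in>carrier M. z \<otimes>\<^bsub>M\<^esub> n = z \<and> n \<otimes>\<^bsub>M\<^esub> z = z)"

definition punctually_locally_connected ::
    "'u set set \<Rightarrow> ('m, 'z) monoid_scheme \<Rightarrow> bool" where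
  "punctually_locally_connected S M \<longleftrightarrow>
     epic (functor_cat (PSh S M) (SET S)) (Gamma_fun M) (C_fun M) (alpha S M)"

definition copunctually_locally_connected ::
    "'u set set \<Rightarrow> ('m, 'z) monoid_scheme \<Rightarrow> bool" where
  "copunctually_locally_connected S M \<longleftrightarrow>
     monic (functor_cat (PSh S M) (SET S)) (Gamma_fun M) (C_fun M) (alpha S M)"

definition bipunctually_locally_connected ::
    "'u set set \<Rightarrow> ('m, 'z) monoid_scheme \<Rightarrow> bool" where
  "bipunctually_locally_connected S M \<longleftrightarrow>
     punctually_locally_connected S M \<and> copunctually_locally_connected S M"

definition is_local :: "'u set set \<Rightarrow> ('m, 'z) monoid_scheme \<Rightarrow> bool" where
  "is_local S M \<longleftrightarrow> (\<exists>R. adjoint (PSh S M) (SET S) (Gamma_fun M) R)"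

definition is_colocal :: "'u set set \<Rightarrow> ('m, 'z) monoid_scheme \<Rightarrow> bool" where
  "is_colocal S M \<longleftrightarrow> (\<exists>L. adjoint (SET S) (PSh S M) L (C_fun M))"

definition is_bilocal :: "'u set set \<Rightarrow> ('m, 'z) monoid_scheme \<Rightarrow> bool" where
  "is_bilocal S M \<longleftrightarrow> is_local S M \<and> is_colocal S M"

text \<open>\<open>power_rset I Y\<close> lives over a function type.  This is harmless: \<open>components\<close> and \<open>cls\<close> are
  polymorphic in the type of points, and the condition is invariant under isomorphism.\<close>

definition C_preserves_powers :: "'u set set \<Rightarrow> ('m, 'z) monoid_scheme \<Rightarrow> bool" where
  "C_preserves_powers S M \<longleftrightarrow>
     (\<forall>I\<in>S. \<forall>Y\<in>Obj (PSh S M).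
        bij_betw (\<lambda>y. \<lambda>i\<in>I. cls M Y (y i))
          (components M (power_rset I Y)) (I \<rightarrow>\<^sub>E components M Y))"


subsection \<open>Basic facts\<close>

lemma right_msetD:
  assumes "right_mset M X" "x \<in> pts X"
  shows "m \<in> carrier M \<Longrightarrow> act X x m \<in> pts X" "act X x \<one>\<^bsub>M\<^esub> = x"
    "m \<in> carrier M \<Longrightarrow> n \<in> carrier M \<Longrightarrow> act X x (m \<otimes>\<^bsub>M\<^esub> n) = act X (act X x m) n"
  using assms by (auto simp: right_mset_def)

lemma conn_equiv:
  assumes "right_mset M X"
  shows "equiv (pts X) (conn M X)"
proof -
  have "equiv (pts X) (pts X \<times> pts X)"
    by (auto simp: equiv_def refl_on_def sym_def trans_def)
  moreover have "\<forall>x\<in>pts X. \<forall>m\<in>carrier M. (x, act X x m) \<in> pts X \<times> pts X"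
    using assms by (auto simp: right_mset_def)
  ultimately have "conn M X \<subseteq> pts X \<times> pts X"
    unfolding conn_def by blast
  moreover have "refl_on (pts X) (conn M X)"
    by (rule refl_onI) (auto simp: conn_def equiv_def refl_on_def)
  moreover have "sym (conn M X)"
    by (rule symI) (auto simp: conn_def equiv_def dest: symD)
  moreover have "trans (conn M X)"
  proof (rule transI)
    fix x y z assume "(x, y) \<in> conn M X" "(y, z) \<in> conn M X"
    then show "(x, z) \<in> conn M X"
      unfolding conn_def equiv_def by (blast dest: transD)
  qed
  ultimately show ?thesis
    by (simp add: equiv_def)
qed

lemma conn_step: "x \<in> pts X \<Longrightarrow> m \<in> carrier M \<Longrightarrow> (x, act X x m) \<in> conn M X"
  unfolding conn_def by blast

lemma conn_least:
  assumes "equiv (pts X) R" "\<And>x m. x \<in> pts X \<Longrightarrow> m \<in> carrier M \<Longrightarrow> (x, act X x m) \<in> R"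
  shows "conn M X \<subseteq> R"
  unfolding conn_def using assms by blast

lemma cls_conn:
  assumes "right_mset M X" "x \<in> pts X"
  shows "(x, cls M X x) \<in> conn M X"
proof -
  have "x \<in> conn M X `` {x}"
    using equiv_class_self[OF conn_equiv] assms by fastforce
  then have "cls M X x \<in> conn M X `` {x}"
    unfolding cls_def by (rule someI)
  then show ?thesis by simp
qed

lemma cls_pts:
  assumes "right_mset M X" "x \<in> pts X"
  shows "cls M X x \<in> pts X"
  using equiv_class_eq_iff[OF conn_equiv[OF assms(1)]] cls_conn[OF assms] by simp

lemma cls_eq_iff:
  assumes "right_mset M X" "x \<in> pts X" "y \<in> pts X"
  shows "cls M X x = cls M X y \<longleftrightarrow> (x, y) \<in> conn M X"
proof
  assume "cls M X x = cls M X y"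
  then have "conn M X `` {x} = conn M X `` {y}"
    using equiv_class_eq[OF conn_equiv[OF assms(1)] cls_conn[OF assms(1,2)]]
      equiv_class_eq[OF conn_equiv[OF assms(1)] cls_conn[OF assms(1,3)]] by simp
  then show "(x, y) \<in> conn M X"
    using equiv_class_eq_iff[OF conn_equiv[OF assms(1)]] assms(2,3) by simp
next
  assume "(x, y) \<in> conn M X"
  then show "cls M X x = cls M X y"
    using conn_equiv[OF assms(1)] by (simp add: cls_def equiv_class_eq)
qed

lemma cls_act:
  "right_mset M X \<Longrightarrow> x \<in> pts X \<Longrightarrow> m \<in> carrier M \<Longrightarrow> cls M X (act X x m) = cls M X x"
  using cls_eq_iff[of M X x "act X x m"] conn_step[of x X m M] by (simp add: right_msetD)

lemma cls_cls: "right_mset M X \<Longrightarrow> x \<in> pts X \<Longrightarrow> cls M X (cls M X x) = cls M X x"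
  using cls_eq_iff[of M X x "cls M X x"] cls_conn[of M X x] by (simp add: cls_pts)

lemma components_subset: "right_mset M X \<Longrightarrow> components M X \<subseteq> pts X"
  by (auto simp: components_def cls_pts)

lemma cls_factor:
  assumes "right_mset M X"
    and "\<And>x m. x \<in> pts X \<Longrightarrow> m \<in> carrier M \<Longrightarrow> g (act X x m) = g x"
    and "x \<in> pts X"
  shows "g (cls M X x) = g x"
proof -
  have "conn M X \<subseteq> {(x, y). x \<in> pts X \<and> y \<in> pts X \<and> g x = g y}"
    using assms(1,2)
    by (intro conn_least) (auto simp: equiv_def refl_on_def sym_def trans_def right_msetD)
  then show ?thesis using cls_conn[OF assms(1,3)] by auto
qed

lemma equivariantD:
  assumes "f \<in> equivariant M X Y"
  shows "f \<in> pts X \<rightarrow>\<^sub>E pts Y" "x \<in> pts X \<Longrightarrow> f x \<in> pts Y"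
    "x \<in> pts X \<Longrightarrow> m \<in> carrier M \<Longrightarrow> f (act X x m) = act Y (f x) m"
  using assms by (auto simp: equivariant_def)

lemma cls_map:
  assumes "right_mset M X" "right_mset M Y" "f \<in> equivariant M X Y" "x \<in> pts X"
  shows "cls M Y (f (cls M X x)) = cls M Y (f x)"
  by (rule cls_factor[where g = "\<lambda>x. cls M Y (f x)"])
    (use assms in \<open>auto simp: equivariantD cls_act\<close>)

lemma SET_simps [simp]:
  "Obj (SET S) = S" "Hom (SET S) A B = A \<rightarrow>\<^sub>E B" "Ident (SET S) A = (\<lambda>x\<in>A. x)"
  "Comp (SET S) A B C g f = compose A g f"
  by (simp_all add: SET_def)

lemma PSh_simps [simp]:
  "X \<in> Obj (PSh S M) \<longleftrightarrow> right_mset M X \<and> pts X \<in> S" "Hom (PSh S M) X Y = equivariant M X Y"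
  "Ident (PSh S M) X = (\<lambda>x\<in>pts X. x)" "Comp (PSh S M) X Y Z g f = compose (pts X) g f"
  by (simp_all add: PSh_def)

lemma equivariant_id: "right_mset M X \<Longrightarrow> (\<lambda>x\<in>pts X. x) \<in> equivariant M X X"
  by (simp add: equivariant_def right_msetD)

lemma equivariant_compose:
  "f \<in> equivariant M X Y \<Longrightarrow> g \<in> equivariant M Y Z \<Longrightarrow> right_mset M X
    \<Longrightarrow> compose (pts X) g f \<in> equivariant M X Z"
  by (simp add: equivariant_def right_msetD compose_def PiE_iff)

lemma compose_units:
  assumes "f \<in> A \<rightarrow>\<^sub>E B"
  shows "compose A f (\<lambda>x\<in>A. x) = f" "compose A (\<lambda>y\<in>B. y) f = f"
  using assms by (auto simp: fun_eq_iff compose_def PiE_iff extensional_def)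

lemma compose_compose:
  assumes "f \<in> A \<rightarrow>\<^sub>E B"
  shows "compose A h (compose A g f) = compose A (compose B h g) f"
  using assms by (auto simp: fun_eq_iff compose_def)

lemma compose_PiE: "f \<in> A \<rightarrow>\<^sub>E B \<Longrightarrow> g \<in> B \<rightarrow>\<^sub>E C \<Longrightarrow> compose A g f \<in> A \<rightarrow>\<^sub>E C"
  by (simp add: compose_def PiE_iff)

lemma right_mset_power: "right_mset M Y \<Longrightarrow> right_mset M (power_rset I Y)"
  by (auto simp: right_mset_def power_rset_def fun_eq_iff PiE_iff extensional_def)

text \<open>The map \<open>C(Y\<^sup>I) \<rightarrow> C(Y)\<^sup>I\<close> does not depend on the chosen representatives.\<close>

lemma power_cls:
  assumes "right_mset M Y" "y \<in> I \<rightarrow>\<^sub>E pts Y"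
  shows "(\<lambda>i\<in>I. cls M Y (cls M (power_rset I Y) y i)) = (\<lambda>i\<in>I. cls M Y (y i))"
proof (rule cls_factor[OF right_mset_power[OF assms(1)], where g = "\<lambda>y. \<lambda>i\<in>I. cls M Y (y i)"])
  fix x m assume "x \<in> pts (power_rset I Y)" "m \<in> carrier M"
  then show "(\<lambda>i\<in>I. cls M Y (act (power_rset I Y) x m i)) = (\<lambda>i\<in>I. cls M Y (x i))"
    by (intro restrict_ext) (simp add: power_rset_def cls_act[OF assms(1)] PiE_iff)
qed (use assms(2) in \<open>simp add: power_rset_def\<close>)

lemma category_SET: "is_category (SET S)"
  unfolding is_category_def
  by (intro conjI ballI) (simp_all add: compose_units compose_compose compose_PiE)

lemma category_PSh: "is_category (PSh S M)"
  unfolding is_category_def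
  by (intro conjI ballI)
    (simp_all add: equivariant_id equivariant_compose compose_units[OF equivariantD(1)]
      compose_compose[OF equivariantD(1)])

lemma category_functor_cat:
  assumes B: "is_category \<B>"
  shows "is_category (functor_cat \<A> \<B>)"
proof -
  have B_id: "Ident \<B> X \<in> Hom \<B> X X" if "X \<in> Obj \<B>" for X
    using B that unfolding is_category_def by blast
  have B_comp: "Comp \<B> X Y Z g f \<in> Hom \<B> X Z"
    if "X \<in> Obj \<B>" "Y \<in> Obj \<B>" "Z \<in> Obj \<B>" "f \<in> Hom \<B> X Y" "g \<in> Hom \<B> Y Z"
    for X Y Z f g
    using B that unfolding is_category_def by blast
  have B_unit: "Comp \<B> X X Y f (Ident \<B> X) = f" "Comp \<B> X Y Y (Ident \<B> Y) f = f"
    if "X \<in> Obj \<B>" "Y \<in> Obj \<B>" "f \<in> Hom \<B> X Y" for X Y f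
    using B that unfolding is_category_def by blast+
  have B_assoc:
    "Comp \<B> W Y Z h (Comp \<B> W X Y g f) = Comp \<B> W X Z (Comp \<B> X Y Z h g) f"
    if "W \<in> Obj \<B>" "X \<in> Obj \<B>" "Y \<in> Obj \<B>" "Z \<in> Obj \<B>"
      "f \<in> Hom \<B> W X" "g \<in> Hom \<B> X Y" "h \<in> Hom \<B> Y Z" for W X Y Z f g h
    using B that unfolding is_category_def by blast
  have F_obj: "fobj F X \<in> Obj \<B>" if "is_functor \<A> \<B> F" "X \<in> Obj \<A>" for F X
    using that by (simp add: is_functor_def)
  have F_map: "fmap F X Y f \<in> Hom \<B> (fobj F X) (fobj F Y)"
    if "is_functor \<A> \<B> F" "X \<in> Obj \<A>" "Y \<in> Obj \<A>" "f \<in> Hom \<A> X Y" for F X Y f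
    using that by (simp add: is_functor_def)
  have N_hom: "\<eta> X \<in> Hom \<B> (fobj F X) (fobj G X)"
    if "natural \<A> \<B> F G \<eta>" "X \<in> Obj \<A>" for F G \<eta> X
    using that by (simp add: natural_def)
  have N_nat: "Comp \<B> (fobj F X) (fobj F Y) (fobj G Y) (\<eta> Y) (fmap F X Y f) =
               Comp \<B> (fobj F X) (fobj G X) (fobj G Y) (fmap G X Y f) (\<eta> X)"
    if "natural \<A> \<B> F G \<eta>" "X \<in> Obj \<A>" "Y \<in> Obj \<A>" "f \<in> Hom \<A> X Y" for F G \<eta> X Y f
    using that by (simp add: natural_def)
  have comp_nat: "natural \<A> \<B> F H
      (\<lambda>X\<in>Obj \<A>. Comp \<B> (fobj F X) (fobj G X) (fobj H X) (\<theta> X) (\<eta> X))"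
    if F: "is_functor \<A> \<B> F" and G: "is_functor \<A> \<B> G" and H: "is_functor \<A> \<B> H"
      and \<eta>: "natural \<A> \<B> F G \<eta>" and \<theta>: "natural \<A> \<B> G H \<theta>" for F G H \<eta> \<theta>
    unfolding natural_def
  proof (intro conjI ballI)
    fix X assume "X \<in> Obj \<A>"
    then show "(\<lambda>X\<in>Obj \<A>. Comp \<B> (fobj F X) (fobj G X) (fobj H X) (\<theta> X) (\<eta> X)) X
        \<in> Hom \<B> (fobj F X) (fobj H X)"
      using F G H \<eta> \<theta> by (simp add: B_comp F_obj N_hom)
  next
    fix X Y f assume X: "X \<in> Obj \<A>" and Y: "Y \<in> Obj \<A>" and f: "f \<in> Hom \<A> X Y"
    note [simp] = X Y f F G H \<eta> \<theta>
    have "Comp \<B> (fobj F X) (fobj F Y) (fobj H Y)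
            (Comp \<B> (fobj F Y) (fobj G Y) (fobj H Y) (\<theta> Y) (\<eta> Y)) (fmap F X Y f)
        = Comp \<B> (fobj F X) (fobj G Y) (fobj H Y) (\<theta> Y)
            (Comp \<B> (fobj F X) (fobj F Y) (fobj G Y) (\<eta> Y) (fmap F X Y f))"
      by (rule B_assoc[symmetric]) (simp_all add: F_obj F_map N_hom)
    also have "\<dots> = Comp \<B> (fobj F X) (fobj G Y) (fobj H Y) (\<theta> Y)
            (Comp \<B> (fobj F X) (fobj G X) (fobj G Y) (fmap G X Y f) (\<eta> X))"
      by (simp add: N_nat[OF \<eta>])
    also have "\<dots> = Comp \<B> (fobj F X) (fobj G X) (fobj H Y)
            (Comp \<B> (fobj G X) (fobj G Y) (fobj H Y) (\<theta> Y) (fmap G X Y f)) (\<eta> X)"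
      by (rule B_assoc) (simp_all add: F_obj F_map N_hom)
    also have "\<dots> = Comp \<B> (fobj F X) (fobj G X) (fobj H Y)
            (Comp \<B> (fobj G X) (fobj H X) (fobj H Y) (fmap H X Y f) (\<theta> X)) (\<eta> X)"
      by (simp add: N_nat[OF \<theta>])
    also have "\<dots> = Comp \<B> (fobj F X) (fobj H X) (fobj H Y) (fmap H X Y f)
            (Comp \<B> (fobj F X) (fobj G X) (fobj H X) (\<theta> X) (\<eta> X))"
      by (rule B_assoc[symmetric]) (simp_all add: F_obj F_map N_hom)
    finally show "Comp \<B> (fobj F X) (fobj F Y) (fobj H Y)
          ((\<lambda>X\<in>Obj \<A>. Comp \<B> (fobj F X) (fobj G X) (fobj H X) (\<theta> X) (\<eta> X)) Y) (fmap F X Y f)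
        = Comp \<B> (fobj F X) (fobj H X) (fobj H Y) (fmap H X Y f)
          ((\<lambda>X\<in>Obj \<A>. Comp \<B> (fobj F X) (fobj G X) (fobj H X) (\<theta> X) (\<eta> X)) X)"
      by simp
  qed
  have id_nat: "natural \<A> \<B> F F (\<lambda>X\<in>Obj \<A>. Ident \<B> (fobj F X))" if "is_functor \<A> \<B> F" for F
    using that by (simp add: natural_def B_id B_unit F_obj F_map)
  show ?thesis
    unfolding is_category_def
  proof (intro conjI ballI)
    fix F G f
    assume "F \<in> Obj (functor_cat \<A> \<B>)" "G \<in> Obj (functor_cat \<A> \<B>)"
      "f \<in> Hom (functor_cat \<A> \<B>) F G"
    then show "Comp (functor_cat \<A> \<B>) F F G f (Ident (functor_cat \<A> \<B>) F) = f"
      "Comp (functor_cat \<A> \<B>) F G G (Ident (functor_cat \<A> \<B>) G) f = f"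
      by (auto simp: functor_cat_def fun_eq_iff extensional_def B_unit F_obj N_hom)
  next
    fix F G H K f g h
    assume "F \<in> Obj (functor_cat \<A> \<B>)" "G \<in> Obj (functor_cat \<A> \<B>)"
      "H \<in> Obj (functor_cat \<A> \<B>)" "K \<in> Obj (functor_cat \<A> \<B>)"
      "f \<in> Hom (functor_cat \<A> \<B>) F G" "g \<in> Hom (functor_cat \<A> \<B>) G H"
      "h \<in> Hom (functor_cat \<A> \<B>) H K"
    then show "Comp (functor_cat \<A> \<B>) F H K h (Comp (functor_cat \<A> \<B>) F G H g f) =
        Comp (functor_cat \<A> \<B>) F G K (Comp (functor_cat \<A> \<B>) G H K h g) f"
      by (auto simp: functor_cat_def fun_eq_iff B_assoc F_obj N_hom)
  qed (simp_all add: functor_cat_def id_nat comp_nat)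
qed

lemma functor_Delta: "is_functor (SET S) (PSh S M) Delta_fun"
  by (auto simp: is_functor_def SET_def PSh_def Delta_fun_def right_mset_def equivariant_def)

lemma fobj_simps [simp]:
  "fobj Delta_fun A = \<lparr> pts = A, act = (\<lambda>x m. x) \<rparr>" "fmap Delta_fun A B h = h"
  "fobj (Gamma_fun M) X = fixed_points M X"
  "fmap (Gamma_fun M) X Y f = restrict f (fixed_points M X)"
  "fobj (C_fun M) X = components M X"
  "fmap (C_fun M) X Y f = (\<lambda>c\<in>components M X. cls M Y (f c))"
  by (simp_all add: Delta_fun_def Gamma_fun_def C_fun_def)

lemma universe_subset: "set_universe S \<Longrightarrow> A \<in> S \<Longrightarrow> B \<subseteq> A \<Longrightarrow> B \<in> S"
  unfolding set_universe_def by blast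

lemma fixed_subset: "fixed_points M X \<subseteq> pts X"
  by (auto simp: fixed_points_def)

lemma fixed_pts: "x \<in> fixed_points M X \<Longrightarrow> x \<in> pts X"
  by (simp add: fixed_points_def)

lemma fixed_map:
  "f \<in> equivariant M X Y \<Longrightarrow> x \<in> fixed_points M X \<Longrightarrow> f x \<in> fixed_points M Y"
  unfolding fixed_points_def mem_Collect_eq by (metis equivariantD(2,3))

lemma functor_Gamma:
  assumes "set_universe S"
  shows "is_functor (PSh S M) (SET S) (Gamma_fun M)"
  unfolding is_functor_def
proof (intro conjI ballI)
  fix X Y Z f g
  assume "f \<in> Hom (PSh S M) X Y" "g \<in> Hom (PSh S M) Y Z"
  then show "fmap (Gamma_fun M) X Z (Comp (PSh S M) X Y Z g f) =
      Comp (SET S) (fobj (Gamma_fun M) X) (fobj (Gamma_fun M) Y) (fobj (Gamma_fun M) Z)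
        (fmap (Gamma_fun M) Y Z g) (fmap (Gamma_fun M) X Y f)"
    using fixed_map[of f M X Y] fixed_subset[of M X] by (auto simp: fun_eq_iff compose_def)
qed (use assms in
    \<open>auto intro: universe_subset[OF _ _ fixed_subset] fixed_map fixed_pts simp: fun_eq_iff\<close>)

lemma cls_component: "right_mset M X \<Longrightarrow> c \<in> components M X \<Longrightarrow> cls M X c = c"
  by (auto simp: components_def cls_cls)

lemma component_pts: "right_mset M X \<Longrightarrow> c \<in> components M X \<Longrightarrow> c \<in> pts X"
  by (auto simp: components_def cls_pts)

lemma cls_in_components: "x \<in> pts X \<Longrightarrow> cls M X x \<in> components M X"
  by (simp add: components_def)

lemma functor_C:
  assumes "set_universe S"
  shows "is_functor (PSh S M) (SET S) (C_fun M)"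
  unfolding is_functor_def
proof (intro conjI ballI)
  fix X Y Z f g
  assume "X \<in> Obj (PSh S M)" "Y \<in> Obj (PSh S M)" "Z \<in> Obj (PSh S M)"
    "f \<in> Hom (PSh S M) X Y" "g \<in> Hom (PSh S M) Y Z"
  then show "fmap (C_fun M) X Z (Comp (PSh S M) X Y Z g f) =
      Comp (SET S) (fobj (C_fun M) X) (fobj (C_fun M) Y) (fobj (C_fun M) Z)
        (fmap (C_fun M) Y Z g) (fmap (C_fun M) X Y f)"
    by (auto simp: fun_eq_iff compose_def component_pts cls_in_components equivariantD cls_map)
next
  fix X assume "X \<in> Obj (PSh S M)"
  then show "fmap (C_fun M) X X (Ident (PSh S M) X) = Ident (SET S) (fobj (C_fun M) X)"
    by (auto simp: fun_eq_iff component_pts cls_component)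
qed (use assms in \<open>auto intro: universe_subset[OF _ _ components_subset]
      simp: component_pts cls_in_components equivariantD\<close>)

lemma natural_alpha:
  "alpha S M \<in> Hom (functor_cat (PSh S M) (SET S)) (Gamma_fun M) (C_fun M)"
proof -
  have "natural (PSh S M) (SET S) (Gamma_fun M) (C_fun M) (alpha S M)"
    unfolding natural_def
  proof (intro conjI ballI)
    fix X Y f assume "X \<in> Obj (PSh S M)" "Y \<in> Obj (PSh S M)" "f \<in> Hom (PSh S M) X Y"
    then show "Comp (SET S) (fobj (Gamma_fun M) X) (fobj (Gamma_fun M) Y) (fobj (C_fun M) Y)
          (alpha S M Y) (fmap (Gamma_fun M) X Y f) =
        Comp (SET S) (fobj (Gamma_fun M) X) (fobj (C_fun M) X) (fobj (C_fun M) Y)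
          (fmap (C_fun M) X Y f) (alpha S M X)"
      using fixed_map[of f M X Y]
      by (auto simp: alpha_def fun_eq_iff compose_def fixed_pts cls_in_components cls_map)
  qed (auto simp: alpha_def fixed_pts cls_in_components)
  then show ?thesis
    by (simp add: functor_cat_def alpha_def)
qed

lemma adjoint_Delta_Gamma:
  assumes "set_universe S"
  shows "adjoint (SET S) (PSh S M) Delta_fun (Gamma_fun M)"
proof -
  have eq: "equivariant M \<lparr> pts = A, act = (\<lambda>x m. x) \<rparr> X = A \<rightarrow>\<^sub>E fixed_points M X"
    for A :: "'a set" and X :: "('a, 'b) rset"
  proof (rule Set.set_eqI)
    fix f :: "'a \<Rightarrow> 'a"
    have "(f x = act X (f x) m) = (act X (f x) m = f x)" for x m by auto
    then show "f \<in> equivariant M \<lparr> pts = A, act = (\<lambda>x m. x) \<rparr> X \<longleftrightarrow> f \<in> A \<rightarrow>\<^sub>E fixed_points M X"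
      by (auto simp: equivariant_def fixed_points_def PiE_iff)
  qed
  show ?thesis
    unfolding adjoint_def
  proof (intro conjI functor_Delta functor_Gamma[OF assms] exI[of _ "\<lambda>A X f. f"] ballI)
    fix A A' X Y h k f
    assume "h \<in> Hom (SET S) A' A" "k \<in> Hom (PSh S M) X Y"
      "f \<in> Hom (PSh S M) (fobj Delta_fun A) X"
    then show "Comp (PSh S M) (fobj Delta_fun A') X Y k
          (Comp (PSh S M) (fobj Delta_fun A') (fobj Delta_fun A) X f (fmap Delta_fun A' A h)) =
        Comp (SET S) A' (fobj (Gamma_fun M) X) (fobj (Gamma_fun M) Y)
          (fmap (Gamma_fun M) X Y k) (Comp (SET S) A' A (fobj (Gamma_fun M) X) f h)"
      by (auto simp: eq fun_eq_iff compose_def)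
  qed (simp add: eq bij_betw_def inj_on_def)
qed

lemma adjoint_C_Delta:
  assumes "set_universe S"
  shows "adjoint (PSh S M) (SET S) (C_fun M) Delta_fun"
  unfolding adjoint_def
proof (intro conjI functor_Delta functor_C[OF assms]
    exI[of _ "\<lambda>X A f. \<lambda>x\<in>pts X. f (cls M X x)"] ballI)
  fix X A assume "X \<in> Obj (PSh S M)" "A \<in> Obj (SET S)"
  then have X: "right_mset M X" by simp
  have inv: "g (cls M X x) = g x"
    if "g \<in> equivariant M X \<lparr> pts = A, act = (\<lambda>x m. x) \<rparr>" "x \<in> pts X" for g x
    by (rule cls_factor[OF X _ that(2)]) (simp add: equivariantD(3)[OF that(1)])
  show "bij_betw (\<lambda>f. \<lambda>x\<in>pts X. f (cls M X x)) (Hom (SET S) (fobj (C_fun M) X) A)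
      (Hom (PSh S M) X (fobj Delta_fun A))"
  proof (rule bij_betw_byWitness[where f' = "\<lambda>g. restrict g (components M X)"])
    show "\<forall>f\<in>Hom (SET S) (fobj (C_fun M) X) A.
        restrict (\<lambda>x\<in>pts X. f (cls M X x)) (components M X) = f"
      by (intro ballI extensionalityI[where A = "components M X"])
        (simp_all add: X component_pts[OF X] cls_component PiE_iff del: restrict_restrict)
    show "\<forall>g\<in>Hom (PSh S M) X (fobj Delta_fun A).
        (\<lambda>x\<in>pts X. restrict g (components M X) (cls M X x)) = g"
    proof
      fix g assume "g \<in> Hom (PSh S M) X (fobj Delta_fun A)"
      then have g: "g \<in> equivariant M X \<lparr> pts = A, act = (\<lambda>x m. x) \<rparr>" by simp
      show "(\<lambda>x\<in>pts X. restrict g (components M X) (cls M X x)) = g"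
        using inv[OF g] equivariantD(1)[OF g]
        by (intro extensionalityI[where A = "pts X"]) (simp_all add: cls_in_components PiE_iff)
    qed
    show "(\<lambda>f. \<lambda>x\<in>pts X. f (cls M X x)) ` Hom (SET S) (fobj (C_fun M) X) A
        \<subseteq> Hom (PSh S M) X (fobj Delta_fun A)"
      by (rule image_subsetI)
        (simp add: X equivariant_def cls_in_components cls_act right_msetD[OF X] PiE_iff)
    show "(\<lambda>g. restrict g (components M X)) ` Hom (PSh S M) X (fobj Delta_fun A)
        \<subseteq> Hom (SET S) (fobj (C_fun M) X) A"
      by (rule image_subsetI) (simp add: component_pts[OF X] equivariant_def PiE_iff)
  qed
next
  fix X X' A A' h k f
  assume "X \<in> Obj (PSh S M)" "X' \<in> Obj (PSh S M)" "h \<in> Hom (PSh S M) X' X"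
  then show "(\<lambda>x\<in>pts X'. Comp (SET S) (fobj (C_fun M) X') A A' k
        (Comp (SET S) (fobj (C_fun M) X') (fobj (C_fun M) X) A f (fmap (C_fun M) X' X h))
        (cls M X' x)) =
      Comp (PSh S M) X' (fobj Delta_fun A) (fobj Delta_fun A') (fmap Delta_fun A A' k)
        (Comp (PSh S M) X' X (fobj Delta_fun A) (\<lambda>x\<in>pts X. f (cls M X x)) h)"
    by (auto simp: fun_eq_iff compose_def cls_in_components cls_map equivariantD)
qed

end

theory Submission
  imports Defs
begin

text \<open>
  A zero element \<open>z\<close> makes \<open>x \<mapsto> x z\<close> pick the unique fixed point of every component, so \<open>\<alpha>\<close> is
  invertible, and \<open>\<Delta>\<close> is both left and right adjoint to \<open>\<Gamma> \<cong> C\<close>; everything else follows.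
  Conversely, the fixed points of the regular \<open>M\<close>-set are the left zeros of \<open>M\<close>, and \<open>n l\<close> is a
  left zero if \<open>l\<close> is. So \<open>M\<close> has a zero as soon as its left zeros exist and coincide, and each
  condition is tested on the regular \<open>M\<close>-set, which is connected. The interesting case is the
  preservation of powers: from two distinct left zeros one builds a connected \<open>M\<close>-set with points at
  unbounded zigzag distance, whose countable power is disconnected.
\<close>

section \<open>Categories and universes\<close>

lemma isomorphism_imp_split_monic: "isomorphism \<C> X Y f \<Longrightarrow> split_monic \<C> X Y f"
  unfolding isomorphism_def split_monic_def by blast

lemma category_unit:
  assumes "is_category \<C>" "X \<in> Obj \<C>" "Y \<in> Obj \<C>" "f \<in> Hom \<C> X Y"
  shows "Comp \<C> X X Y f (Ident \<C> X) = f" "Comp \<C> X Y Y (Ident \<C> Y) f = f"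
  using assms by (simp_all add: is_category_def)

lemma category_assoc:
  assumes "is_category \<C>" "W \<in> Obj \<C>" "X \<in> Obj \<C>" "Y \<in> Obj \<C>" "Z \<in> Obj \<C>"
    "f \<in> Hom \<C> W X" "g \<in> Hom \<C> X Y" "h \<in> Hom \<C> Y Z"
  shows "Comp \<C> W Y Z h (Comp \<C> W X Y g f) = Comp \<C> W X Z (Comp \<C> X Y Z h g) f"
  using assms by (simp add: is_category_def)

lemma category_comp:
  assumes "is_category \<C>" "X \<in> Obj \<C>" "Y \<in> Obj \<C>" "Z \<in> Obj \<C>"
    "f \<in> Hom \<C> X Y" "g \<in> Hom \<C> Y Z"
  shows "Comp \<C> X Y Z g f \<in> Hom \<C> X Z"
  using assms by (simp add: is_category_def)

lemma isomorphism_imp_monic: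
  assumes C: "is_category \<C>" and "isomorphism \<C> X Y f"
  shows "monic \<C> X Y f"
proof -
  obtain r where XY: "X \<in> Obj \<C>" "Y \<in> Obj \<C>" "f \<in> Hom \<C> X Y"
    and r: "r \<in> Hom \<C> Y X" "Comp \<C> X Y X r f = Ident \<C> X"
    using assms(2) unfolding isomorphism_def by blast
  have "Comp \<C> W Y X r (Comp \<C> W X Y f k) = k" if "W \<in> Obj \<C>" "k \<in> Hom \<C> W X" for W k
    using category_assoc[OF C that(1) XY(1,2,1) that(2) XY(3) r(1)]
      category_unit(2)[OF C that(1) XY(1) that(2)] r(2) by simp
  then show ?thesis
    using XY unfolding monic_def by metis
qed

lemma isomorphism_imp_epic:
  assumes C: "is_category \<C>" and "isomorphism \<C> X Y f"
  shows "epic \<C> X Y f"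
proof -
  obtain s where XY: "X \<in> Obj \<C>" "Y \<in> Obj \<C>" "f \<in> Hom \<C> X Y"
    and s: "s \<in> Hom \<C> Y X" "Comp \<C> Y X Y f s = Ident \<C> Y"
    using assms(2) unfolding isomorphism_def by blast
  have "Comp \<C> Y X Z (Comp \<C> X Y Z k f) s = k" if "Z \<in> Obj \<C>" "k \<in> Hom \<C> Y Z" for Z k
    using category_assoc[OF C XY(2,1,2) that(1) s(1) XY(3) that(2)]
      category_unit(1)[OF C XY(2) that] s(2) by simp
  then show ?thesis
    using XY unfolding epic_def by metis
qed

text \<open>Two arrows into \<open>fobj R X\<close> that agree after composition with the image of
  \<open>f\<close> have transposes that agree after composition with \<open>f\<close>; these
  transposes are equal because \<open>f\<close> is monic. The case needed is
  \<open>R = C_fun M\<close>.\<close>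

lemma right_adjoint_preserves_monos:
  assumes adj: "adjoint \<A> \<B> L R" and A: "is_category \<A>" and B: "is_category \<B>"
  shows "preserves_monos \<B> \<A> R"
  unfolding preserves_monos_def
proof (intro allI impI)
  fix X Y f assume f: "monic \<B> X Y f"
  then have XY: "X \<in> Obj \<B>" "Y \<in> Obj \<B>" "f \<in> Hom \<B> X Y"
    by (auto simp: monic_def)
  have L: "is_functor \<A> \<B> L" and R: "is_functor \<B> \<A> R"
    using adj by (auto simp: adjoint_def)
  obtain \<phi> where bij: "\<forall>W\<in>Obj \<A>. \<forall>X\<in>Obj \<B>.
      bij_betw (\<phi> W X) (Hom \<B> (fobj L W) X) (Hom \<A> W (fobj R X))"
    and nat: "\<forall>W\<in>Obj \<A>. \<forall>W'\<in>Obj \<A>. \<forall>X\<in>Obj \<B>. \<forall>X'\<in>Obj \<B>.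
      \<forall>h\<in>Hom \<A> W' W. \<forall>k\<in>Hom \<B> X X'. \<forall>f\<in>Hom \<B> (fobj L W) X.
        \<phi> W' X' (Comp \<B> (fobj L W') X X' k
                   (Comp \<B> (fobj L W') (fobj L W) X f (fmap L W' W h))) =
        Comp \<A> W' (fobj R X) (fobj R X') (fmap R X X' k)
          (Comp \<A> W' W (fobj R X) (\<phi> W X f) h)"
    using adj unfolding adjoint_def by (elim conjE exE) (rule that)
  have RXY: "fobj R X \<in> Obj \<A>" "fobj R Y \<in> Obj \<A>" "fmap R X Y f \<in> Hom \<A> (fobj R X) (fobj R Y)"
    using R XY by (auto simp: is_functor_def)
  have "u = v" if W: "W \<in> Obj \<A>" and u: "u \<in> Hom \<A> W (fobj R X)" and v: "v \<in> Hom \<A> W (fobj R X)"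
    and eq: "Comp \<A> W (fobj R X) (fobj R Y) (fmap R X Y f) u =
      Comp \<A> W (fobj R X) (fobj R Y) (fmap R X Y f) v" for W u v
  proof -
    note bij_X = bij[rule_format, OF W XY(1)]
    have LW: "fobj L W \<in> Obj \<B>" "fmap L W W (Ident \<A> W) = Ident \<B> (fobj L W)"
      using L W by (auto simp: is_functor_def)
    have id: "Ident \<A> W \<in> Hom \<A> W W"
      using A W by (simp add: is_category_def)
    note unit_A = category_unit(1)[OF A W RXY(1)] and unit_B = category_unit(1)[OF B LW(1) XY(1)]
      and comp_B = category_comp[OF B LW(1) XY(1,2) _ XY(3)]
    \<comment> \<open>Naturality is used in the codomain only: the arrow \<open>h\<close> is the
      identity of \<open>W\<close>, which the functor and unit laws remove on both sides.\<close>
    have transpose: "\<phi> W Y (Comp \<B> (fobj L W) X Y f t) =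
        Comp \<A> W (fobj R X) (fobj R Y) (fmap R X Y f) (\<phi> W X t)"
      if "t \<in> Hom \<B> (fobj L W) X" for t
      using nat[rule_format, OF W W XY(1,2) id XY(3) that] bij_X that
      by (simp add: LW unit_A unit_B bij_betw_apply)
    obtain u' v' where u': "u' \<in> Hom \<B> (fobj L W) X" "u = \<phi> W X u'"
      and v': "v' \<in> Hom \<B> (fobj L W) X" "v = \<phi> W X v'"
      using bij_betw_imp_surj_on[OF bij_X] u v by blast
    have "\<phi> W Y (Comp \<B> (fobj L W) X Y f u') = \<phi> W Y (Comp \<B> (fobj L W) X Y f v')"
      using eq by (simp add: transpose u' v')
    then have "Comp \<B> (fobj L W) X Y f u' = Comp \<B> (fobj L W) X Y f v'"
      using bij_betw_imp_inj_on[OF bij[rule_format, OF W XY(2)]] comp_B u'(1) v'(1) by (auto dest: inj_onD)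
    then have "u' = v'"
      using f LW(1) u'(1) v'(1) unfolding monic_def by blast
    then show "u = v" by (simp add: u'(2) v'(2))
  qed
  then show "monic \<A> (fobj R X) (fobj R Y) (fmap R X Y f)"
    using RXY unfolding monic_def by blast
qed

section \<open>Closure properties of a set universe\<close>

lemma universe_image: "set_universe S \<Longrightarrow> A \<in> S \<Longrightarrow> f ` A \<in> S"
  by (simp add: set_universe_def)

lemma universe_UN:
  "set_universe S \<Longrightarrow> A \<in> S \<Longrightarrow> (\<And>a. a \<in> A \<Longrightarrow> B a \<in> S) \<Longrightarrow> (\<Union>a\<in>A. B a) \<in> S"
  by (simp add: set_universe_def)

lemma universe_infinite:
  assumes "set_universe S"
  obtains A where "A \<in> S" "infinite A"
  using assms by (auto simp: set_universe_def)

text \<open>Pairing comes from replacement: an infinite small set has two distinct points, so a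
  function on it can take exactly the values \<open>a\<close> and \<open>b\<close>.\<close>

lemma universe_doubleton:
  assumes "set_universe S"
  shows "{a, b} \<in> S"
proof -
  obtain A where A: "A \<in> S" "infinite A"
    using universe_infinite[OF assms] .
  then obtain x where x: "x \<in> A" by (metis finite.emptyI ex_in_conv)
  have "A - {x} \<noteq> {}" using infinite_remove[OF A(2), of x] by (intro notI) simp
  then have "(\<lambda>t. if t = x then a else b) ` A = {a, b}"
    using x by auto
  then show ?thesis using universe_image[OF assms A(1), of "\<lambda>t. if t = x then a else b"] by simp
qed

lemma universe_singleton: "set_universe S \<Longrightarrow> {a} \<in> S"
  using universe_doubleton[of S a a] by simp

lemma universe_empty: "set_universe S \<Longrightarrow> {} \<in> S"
  by (rule universe_subset[OF _ universe_singleton]) simp_all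

lemma universe_infinite_UNIV:
  fixes S :: "'u set set"
  assumes "set_universe S"
  shows "infinite (UNIV :: 'u set)"
proof -
  obtain A :: "'u set" where "A \<in> S" "infinite A"
    using universe_infinite[OF assms] .
  then show ?thesis using finite_subset[OF subset_UNIV] by auto
qed

lemma universe_two_elements:
  fixes S :: "'u set set"
  assumes "set_universe S"
  obtains a b :: 'u where "a \<noteq> b"
proof -
  have "(UNIV :: 'u set) \<noteq> {undefined}"
    using universe_infinite_UNIV[OF assms] by (metis finite.emptyI finite_insert)
  then show ?thesis using that by auto
qed

lemma universe_nat:
  fixes S :: "'u set set"
  assumes "set_universe S"
  obtains \<iota> :: "nat \<Rightarrow> 'u" where "inj \<iota>" "range \<iota> \<in> S"
proof -
  obtain A :: "'u set" where A: "A \<in> S" "infinite A"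
    using universe_infinite[OF assms] .
  then obtain \<iota> :: "nat \<Rightarrow> 'u" where "inj \<iota>" "range \<iota> \<subseteq> A"
    using infinite_countable_subset by blast
  then show ?thesis using that universe_subset[OF assms A(1)] by blast
qed

text \<open>The infinite type of points is equipotent to its square, so an injection
  \<open>p\<close> codes pairs inside it. The coded product is a small union of images of a small
  set.\<close>

lemma universe_times:
  fixes S :: "'u set set" and f :: "'a \<Rightarrow> 'u" and g :: "'b \<Rightarrow> 'u"
  assumes "set_universe S" and f: "inj_on f A" "f ` A \<in> S" and g: "inj_on g B" "g ` B \<in> S"
  obtains j :: "'a \<times> 'b \<Rightarrow> 'u" where "inj_on j (A \<times> B)" "j ` (A \<times> B) \<in> S"
proof -
  obtain p :: "'u \<times> 'u \<Rightarrow> 'u" where "inj_on p (UNIV \<times> UNIV)"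
    using card_of_ordLeq[THEN iffD2, OF ordIso_imp_ordLeq[OF card_of_Times_same_infinite[OF
          universe_infinite_UNIV[OF assms(1)]]]] by auto
  then have p: "inj p" by simp
  have "(\<lambda>(a, b). p (f a, g b)) ` (A \<times> B) = (\<Union>u\<in>f ` A. (\<lambda>v. p (u, v)) ` g ` B)"
    by auto
  also have "\<dots> \<in> S"
    by (rule universe_UN[OF assms(1) f(2)]) (rule universe_image[OF assms(1) g(2)])
  finally have "(\<lambda>(a, b). p (f a, g b)) ` (A \<times> B) \<in> S" .
  moreover have "inj_on (\<lambda>(a, b). p (f a, g b)) (A \<times> B)"
    using f(1) g(1) by (auto intro!: inj_onI dest!: injD[OF p] dest: inj_onD)
  ultimately show ?thesis using that by blast
qed

section \<open>A zero element\<close>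

locale zero_element =
  fixes M :: "('m, 'z) monoid_scheme" (structure) and z :: 'm
  assumes zero_carrier: "z \<in> carrier M"
    and zero_left: "n \<in> carrier M \<Longrightarrow> z \<otimes> n = z"
    and zero_right: "n \<in> carrier M \<Longrightarrow> n \<otimes> z = z"
begin

lemma act_zero_fixed: "right_mset M X \<Longrightarrow> x \<in> pts X \<Longrightarrow> act X x z \<in> fixed_points M X"
  unfolding fixed_points_def
  by (auto simp: right_msetD zero_carrier zero_left simp flip: right_msetD(3))

lemma act_act_zero:
  "right_mset M X \<Longrightarrow> x \<in> pts X \<Longrightarrow> m \<in> carrier M \<Longrightarrow> act X (act X x m) z = act X x z"
  by (simp add: zero_carrier zero_right flip: right_msetD(3))

lemma fixed_act_zero: "x \<in> fixed_points M X \<Longrightarrow> act X x z = x"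
  by (simp add: fixed_points_def zero_carrier)

text \<open>Multiplication by \<open>z\<close> is constant along each generating step, since
  \<open>m z = z\<close>, and so depends on the component alone.\<close>

lemma act_zero_cls: "right_mset M X \<Longrightarrow> x \<in> pts X \<Longrightarrow> act X (cls M X x) z = act X x z"
  by (rule cls_factor) (simp_all add: act_act_zero)

lemma cls_act_zero: "right_mset M X \<Longrightarrow> x \<in> pts X \<Longrightarrow> cls M X (act X x z) = cls M X x"
  by (simp add: cls_act zero_carrier)

lemma alpha_isomorphism:
  assumes "set_universe S"
  shows "isomorphism (functor_cat (PSh S M) (SET S)) (Gamma_fun M) (C_fun M) (alpha S M)"
proof -
  \<comment> \<open>The inverse of \<open>\<alpha>\<close> multiplies a representative by
    \<open>z\<close>; by \<open>act_zero_cls\<close> the choice of representative does not affect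
    the result.\<close>
  let ?\<beta> = "\<lambda>X\<in>Obj (PSh S M). \<lambda>c\<in>components M X. act X c z"
  have "natural (PSh S M) (SET S) (C_fun M) (Gamma_fun M) ?\<beta>"
    unfolding natural_def
  proof (intro conjI ballI)
    fix X Y f assume "X \<in> Obj (PSh S M)" "Y \<in> Obj (PSh S M)" "f \<in> Hom (PSh S M) X Y"
    then show "Comp (SET S) (fobj (C_fun M) X) (fobj (C_fun M) Y) (fobj (Gamma_fun M) Y)
          (?\<beta> Y) (fmap (C_fun M) X Y f) =
        Comp (SET S) (fobj (C_fun M) X) (fobj (Gamma_fun M) X) (fobj (Gamma_fun M) Y)
          (fmap (Gamma_fun M) X Y f) (?\<beta> X)"
      by (auto simp: fun_eq_iff compose_def component_pts cls_in_components act_zero_cls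
          act_zero_fixed equivariantD zero_carrier)
  qed (auto simp: component_pts act_zero_fixed)
  then have "?\<beta> \<in> Hom (functor_cat (PSh S M) (SET S)) (C_fun M) (Gamma_fun M)"
    by (simp add: functor_cat_def)
  moreover have
    "Comp (functor_cat (PSh S M) (SET S)) (Gamma_fun M) (C_fun M) (Gamma_fun M) ?\<beta> (alpha S M)
      = Ident (functor_cat (PSh S M) (SET S)) (Gamma_fun M)"
    by (auto simp: functor_cat_def alpha_def fun_eq_iff compose_def fixed_pts cls_in_components
        act_zero_cls fixed_act_zero)
  moreover have
    "Comp (functor_cat (PSh S M) (SET S)) (C_fun M) (Gamma_fun M) (C_fun M) (alpha S M) ?\<beta>
      = Ident (functor_cat (PSh S M) (SET S)) (C_fun M)"
    by (auto simp: functor_cat_def alpha_def fun_eq_iff compose_def component_pts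
        act_zero_fixed cls_act_zero cls_component)
  ultimately show ?thesis
    using functor_Gamma[OF assms] functor_C[OF assms] natural_alpha
    unfolding isomorphism_def by (auto simp: functor_cat_def)
qed

lemma full_Gamma:
  assumes "set_universe S"
  shows "full (PSh S M) (SET S) (Gamma_fun M)"
  unfolding full_def
proof (intro conjI ballI functor_Gamma[OF assms])
  fix X Y g
  assume "X \<in> Obj (PSh S M)" "Y \<in> Obj (PSh S M)"
    and "g \<in> Hom (SET S) (fobj (Gamma_fun M) X) (fobj (Gamma_fun M) Y)"
  then have X: "right_mset M X" and Y: "right_mset M Y"
    and g: "g \<in> fixed_points M X \<rightarrow>\<^sub>E fixed_points M Y"
    by simp_all
  have gz: "g (act X x z) \<in> fixed_points M Y" if "x \<in> pts X" for x
    using g act_zero_fixed[OF X that] by blast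
  \<comment> \<open>\<open>x \<mapsto> x z\<close> retracts \<open>X\<close> onto its fixed points,
    and \<open>g\<close> is extended along it. Equivariance holds because both
    \<open>x \<mapsto> x z\<close> and the values of \<open>g\<close> are unchanged by the
    action.\<close>
  let ?f = "\<lambda>x\<in>pts X. g (act X x z)"
  have "?f \<in> equivariant M X Y"
    using gz by (auto simp: equivariant_def right_msetD[OF X] act_act_zero[OF X] fixed_points_def)
  moreover have "restrict ?f (fixed_points M X) = g"
    using g by (intro extensionalityI[where A = "fixed_points M X"])
      (simp_all add: fixed_pts fixed_act_zero PiE_iff del: restrict_restrict)
  ultimately show "\<exists>f\<in>Hom (PSh S M) X Y. fmap (Gamma_fun M) X Y f = g"
    by (auto intro!: bexI[of _ ?f])
qed

text \<open>An equivariant map \<open>g\<close> into a trivial \<open>M\<close>-set satisfies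
  \<open>g x = g (x z)\<close>, so it is determined by its values at fixed points, and these may be
  prescribed freely.\<close>

lemma adjoint_Gamma_Delta:
  assumes "set_universe S"
  shows "adjoint (PSh S M) (SET S) (Gamma_fun M) Delta_fun"
  unfolding adjoint_def
proof (intro conjI functor_Delta functor_Gamma[OF assms]
    exI[of _ "\<lambda>X A f. \<lambda>x\<in>pts X. f (act X x z)"] ballI)
  fix X A assume "X \<in> Obj (PSh S M)" "A \<in> Obj (SET S)"
  then have X: "right_mset M X" by simp
  show "bij_betw (\<lambda>f. \<lambda>x\<in>pts X. f (act X x z)) (Hom (SET S) (fobj (Gamma_fun M) X) A)
      (Hom (PSh S M) X (fobj Delta_fun A))"
  proof (rule bij_betw_byWitness[where f' = "\<lambda>g. restrict g (fixed_points M X)"])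
    show "\<forall>f\<in>Hom (SET S) (fobj (Gamma_fun M) X) A.
        restrict (\<lambda>x\<in>pts X. f (act X x z)) (fixed_points M X) = f"
      by (intro ballI extensionalityI[where A = "fixed_points M X"])
        (simp_all add: fixed_pts fixed_act_zero PiE_iff del: restrict_restrict)
    show "\<forall>g\<in>Hom (PSh S M) X (fobj Delta_fun A).
        (\<lambda>x\<in>pts X. restrict g (fixed_points M X) (act X x z)) = g"
      by (auto simp: fun_eq_iff act_zero_fixed[OF X] zero_carrier equivariant_def PiE_iff
          extensional_def)
    show "(\<lambda>f. \<lambda>x\<in>pts X. f (act X x z)) ` Hom (SET S) (fobj (Gamma_fun M) X) A
        \<subseteq> Hom (PSh S M) X (fobj Delta_fun A)"
      by (auto simp: equivariant_def act_zero_fixed[OF X] act_act_zero[OF X] right_msetD[OF X]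
          PiE_iff)
    show "(\<lambda>g. restrict g (fixed_points M X)) ` Hom (PSh S M) X (fobj Delta_fun A)
        \<subseteq> Hom (SET S) (fobj (Gamma_fun M) X) A"
      by (auto simp: equivariant_def fixed_pts PiE_iff)
  qed
next
  fix X X' A A' h k f
  assume "X \<in> Obj (PSh S M)" "X' \<in> Obj (PSh S M)" "h \<in> Hom (PSh S M) X' X"
  then show "(\<lambda>x\<in>pts X'. Comp (SET S) (fobj (Gamma_fun M) X') A A' k
        (Comp (SET S) (fobj (Gamma_fun M) X') (fobj (Gamma_fun M) X) A f
          (fmap (Gamma_fun M) X' X h)) (act X' x z)) =
      Comp (PSh S M) X' (fobj Delta_fun A) (fobj Delta_fun A') (fmap Delta_fun A A' k)
        (Comp (PSh S M) X' X (fobj Delta_fun A) (\<lambda>x\<in>pts X. f (act X x z)) h)"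
    by (auto simp: fun_eq_iff compose_def act_zero_fixed equivariantD zero_carrier)
qed

text \<open>A map from a trivial \<open>M\<close>-set is a family of fixed points. Its transpose is
  its composite with \<open>\<alpha>\<close>, which multiplication of representatives by
  \<open>z\<close> inverts.\<close>

lemma adjoint_Delta_C:
  assumes "set_universe S"
  shows "adjoint (SET S) (PSh S M) Delta_fun (C_fun M)"
  unfolding adjoint_def
proof (intro conjI functor_Delta functor_C[OF assms]
    exI[of _ "\<lambda>A X f. \<lambda>a\<in>A. cls M X (f a)"] ballI)
  fix A X assume "A \<in> Obj (SET S)" "X \<in> Obj (PSh S M)"
  then have X: "right_mset M X" by simp
  have fixed: "g \<in> equivariant M (fobj Delta_fun A) X \<longleftrightarrow> g \<in> A \<rightarrow>\<^sub>E fixed_points M X"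
    for g :: "'a \<Rightarrow> 'a"
    by (auto simp: equivariant_def fixed_points_def PiE_iff)
  show "bij_betw (\<lambda>f. \<lambda>a\<in>A. cls M X (f a)) (Hom (PSh S M) (fobj Delta_fun A) X)
      (Hom (SET S) A (fobj (C_fun M) X))"
  proof (rule bij_betw_byWitness[where f' = "\<lambda>g. \<lambda>a\<in>A. act X (g a) z"])
    show "\<forall>f\<in>Hom (PSh S M) (fobj Delta_fun A) X.
        (\<lambda>a\<in>A. act X ((\<lambda>a\<in>A. cls M X (f a)) a) z) = f"
      using fixed by (auto simp: fun_eq_iff PiE_iff extensional_def fixed_pts[of _ M X] act_zero_cls[OF X]
          fixed_act_zero simp del: fobj_simps)
    show "\<forall>g\<in>Hom (SET S) A (fobj (C_fun M) X).
        (\<lambda>a\<in>A. cls M X ((\<lambda>a\<in>A. act X (g a) z) a)) = g"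
      by (auto simp: fun_eq_iff PiE_iff extensional_def component_pts[OF X] cls_act_zero[OF X]
          cls_component[OF X])
    show "(\<lambda>f. \<lambda>a\<in>A. cls M X (f a)) ` Hom (PSh S M) (fobj Delta_fun A) X
        \<subseteq> Hom (SET S) A (fobj (C_fun M) X)"
      by (auto simp: equivariant_def cls_in_components PiE_iff)
    show "(\<lambda>g. \<lambda>a\<in>A. act X (g a) z) ` Hom (SET S) A (fobj (C_fun M) X)
        \<subseteq> Hom (PSh S M) (fobj Delta_fun A) X"
      unfolding image_subset_iff PSh_simps fixed
      by (auto simp: PiE_iff component_pts[OF X] act_zero_fixed[OF X])
  qed
next
  fix A A' X X' h k f
  assume "A \<in> Obj (SET S)" "A' \<in> Obj (SET S)" "X \<in> Obj (PSh S M)" "X' \<in> Obj (PSh S M)"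
    "h \<in> Hom (SET S) A' A" "k \<in> Hom (PSh S M) X X'" "f \<in> Hom (PSh S M) (fobj Delta_fun A) X"
  then show "(\<lambda>a\<in>A'. cls M X' (Comp (PSh S M) (fobj Delta_fun A') X X' k
        (Comp (PSh S M) (fobj Delta_fun A') (fobj Delta_fun A) X f (fmap Delta_fun A' A h)) a)) =
      Comp (SET S) A' (fobj (C_fun M) X) (fobj (C_fun M) X') (fmap (C_fun M) X X' k)
        (Comp (SET S) A' A (fobj (C_fun M) X) (\<lambda>a\<in>A. cls M X (f a)) h)"
    by (auto simp: fun_eq_iff compose_def cls_in_components equivariantD PiE_iff cls_map
        dest: equivariantD(1))
qed

text \<open>In general each coordinate of a family may need its own zigzag to reach the chosen
  representative. Here the single element \<open>z\<close> serves all coordinates at once, whatever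
  the size of \<open>I\<close>.\<close>

lemma preserves_powers: "C_preserves_powers S M"
  unfolding C_preserves_powers_def
proof (intro ballI)
  fix I Y assume "Y \<in> Obj (PSh S M)"
  then have Y: "right_mset M Y" by simp
  let ?P = "power_rset I Y"
  have P: "right_mset M ?P" by (rule right_mset_power[OF Y])
  show "bij_betw (\<lambda>y. \<lambda>i\<in>I. cls M Y (y i)) (components M ?P) (I \<rightarrow>\<^sub>E components M Y)"
  proof (rule bij_betw_byWitness[where f' = "\<lambda>c. cls M ?P c"])
    show "\<forall>y\<in>components M ?P. cls M ?P (\<lambda>i\<in>I. cls M Y (y i)) = y"
    proof
      fix y assume y: "y \<in> components M ?P"
      then have y': "y \<in> pts ?P" by (rule component_pts[OF P])
      then have yI: "y i \<in> pts Y" if "i \<in> I" for i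
        using that by (auto simp: power_rset_def)
      have c: "(\<lambda>i\<in>I. cls M Y (y i)) \<in> pts ?P"
        by (simp add: power_rset_def cls_pts[OF Y] yI)
      \<comment> \<open>Two families that become equal under one element of \<open>M\<close> lie in
        the same component of the power.\<close>
      have "act ?P (\<lambda>i\<in>I. cls M Y (y i)) z = act ?P y z"
        by (auto simp: power_rset_def fun_eq_iff act_zero_cls[OF Y] yI)
      then show "cls M ?P (\<lambda>i\<in>I. cls M Y (y i)) = y"
        using cls_act_zero[OF P c] cls_act_zero[OF P y'] cls_component[OF P y] by simp
    qed
    have cP: "c \<in> pts ?P" if "c \<in> I \<rightarrow>\<^sub>E components M Y" for c
      using that by (auto simp: power_rset_def PiE_iff component_pts[OF Y])
    show "\<forall>c\<in>I \<rightarrow>\<^sub>E components M Y. (\<lambda>i\<in>I. cls M Y (cls M ?P c i)) = c"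
    proof
      fix c assume c: "c \<in> I \<rightarrow>\<^sub>E components M Y"
      then have "(\<lambda>i\<in>I. cls M Y (cls M ?P c i)) = (\<lambda>i\<in>I. cls M Y (c i))"
        using cP[OF c] by (intro power_cls[OF Y]) (simp add: power_rset_def)
      also have "\<dots> = c"
        using c by (intro extensionalityI[where A = I]) (simp_all add: PiE_iff cls_component[OF Y])
      finally show "(\<lambda>i\<in>I. cls M Y (cls M ?P c i)) = c" .
    qed
    show "(\<lambda>y. \<lambda>i\<in>I. cls M Y (y i)) ` components M ?P \<subseteq> I \<rightarrow>\<^sub>E components M Y"
      using component_pts[OF P]
      by (fastforce simp: power_rset_def PiE_iff intro!: cls_in_components)
    show "cls M ?P ` (I \<rightarrow>\<^sub>E components M Y) \<subseteq> components M ?P"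
      using cP by (auto simp: cls_in_components)
  qed
qed

end

section \<open>The regular \<open>M\<close>-set\<close>

definition regular :: "('m, 'z) monoid_scheme \<Rightarrow> ('m, 'm) rset" where
  "regular M = \<lparr> pts = carrier M, act = (\<otimes>\<^bsub>M\<^esub>) \<rparr>"

text \<open>Objects of \<open>PSh S M\<close> have their points in one fixed type;
  \<open>M\<close>-sets built over another type are copied into it along a map \<open>j\<close>
  injective on their points.\<close>

definition transport :: "('y \<Rightarrow> 'x) \<Rightarrow> ('y, 'm) rset \<Rightarrow> ('x, 'm) rset" where
  "transport j Y = \<lparr> pts = j ` pts Y, act = (\<lambda>x m. j (act Y (inv_into (pts Y) j x) m)) \<rparr>"

lemma pts_transport [simp]: "pts (transport j Y) = j ` pts Y"
  by (simp add: transport_def)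

lemma act_transport:
  "inj_on j (pts Y) \<Longrightarrow> y \<in> pts Y \<Longrightarrow> act (transport j Y) (j y) m = j (act Y y m)"
  by (simp add: transport_def)

lemma right_mset_transport:
  assumes "right_mset M Y" "inj_on j (pts Y)"
  shows "right_mset M (transport j Y)"
  using assms(1) unfolding right_mset_def by (simp add: act_transport[OF assms(2)])

lemma right_mset_regular: "monoid M \<Longrightarrow> right_mset M (regular M)"
  by (simp add: right_mset_def regular_def monoid.m_closed monoid.r_one monoid.m_assoc)

lemma right_mset_Delta: "right_mset M (fobj Delta_fun A)"
  by (simp add: right_mset_def)

lemma fixed_points_Delta: "fixed_points M (fobj Delta_fun A) = A"
  by (simp add: fixed_points_def)

section \<open>Monomorphisms and terminal objects in sets and \<open>M\<close>-sets\<close>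

lemma monic_PSh:
  assumes "X \<in> Obj (PSh S M)" "Y \<in> Obj (PSh S M)" "f \<in> equivariant M X Y" "inj_on f (pts X)"
  shows "monic (PSh S M) X Y f"
  unfolding monic_def
proof (intro conjI ballI impI)
  fix W g h
  assume "g \<in> Hom (PSh S M) W X" "h \<in> Hom (PSh S M) W X"
    and eq: "Comp (PSh S M) W X Y f g = Comp (PSh S M) W X Y f h"
  then have g: "g \<in> pts W \<rightarrow>\<^sub>E pts X" and h: "h \<in> pts W \<rightarrow>\<^sub>E pts X"
    by (simp_all add: equivariantD)
  show "g = h"
  proof (rule PiE_ext[OF g h])
    fix w assume w: "w \<in> pts W"
    have "f (g w) = f (h w)"
      using fun_cong[OF eq, of w] w by (simp add: compose_def)
    then show "g w = h w"
      using assms(4) g h w by (auto dest: inj_onD)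
  qed
qed (use assms in auto)

text \<open>Elements of \<open>A\<close> are compared as maps from the small singleton
  \<open>{x}\<close>.\<close>

lemma monic_SET_inj:
  assumes "set_universe S" "monic (SET S) A B f"
  shows "inj_on f A"
proof (rule inj_onI)
  fix x y assume xy: "x \<in> A" "y \<in> A" "f x = f y"
  let ?k = "\<lambda>t. \<lambda>s\<in>{x}. t"
  have "{x} \<in> Obj (SET S)"
    using universe_singleton[OF assms(1)] by simp
  moreover have "?k x \<in> Hom (SET S) {x} A" "?k y \<in> Hom (SET S) {x} A"
    using xy by auto
  moreover have "Comp (SET S) {x} A B f (?k x) = Comp (SET S) {x} A B f (?k y)"
    using xy by (auto simp: compose_def)
  ultimately have "?k x = ?k y"
    using assms(2) unfolding monic_def by blast
  then show "x = y" by (metis insertI1 restrict_apply')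
qed

lemma terminal_SET:
  fixes S :: "'u set set"
  assumes "set_universe S" "terminal (SET S) T"
  obtains a where "T = {a}"
proof -
  have T: "\<exists>!f. f \<in> {a} \<rightarrow>\<^sub>E T" for a :: 'u
    using assms(2) universe_singleton[OF assms(1), of a] unfolding terminal_def SET_simps by blast
  obtain f :: "'u \<Rightarrow> 'u" where f: "f \<in> {undefined} \<rightarrow>\<^sub>E T"
    using ex1_implies_ex[OF T[of undefined]] ..
  have "t = f undefined" if "t \<in> T" for t
  proof -
    have "(\<lambda>s\<in>{undefined}. t) \<in> {undefined} \<rightarrow>\<^sub>E T"
      using that by simp
    then have "(\<lambda>s\<in>{undefined}. t) = f"
      using T[of undefined] f by metis
    then show ?thesis by (metis insertI1 restrict_apply')
  qed
  then have "T = {f undefined}" using f by auto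
  then show ?thesis by (rule that)
qed

lemma preserves_terminal_Delta:
  assumes "set_universe S"
  shows "preserves_terminal (SET S) (PSh S M) Delta_fun"
  unfolding preserves_terminal_def
proof (intro allI impI)
  fix T assume "terminal (SET S) T"
  then obtain a where a: "T = {a}"
    using terminal_SET[OF assms] by blast
  have hom: "f \<in> equivariant M X (fobj Delta_fun {a}) \<longleftrightarrow> f = (\<lambda>x\<in>pts X. a)"
    if "right_mset M X" for X :: "('a, 'b) rset" and f
  proof
    assume "f \<in> equivariant M X (fobj Delta_fun {a})"
    then show "f = (\<lambda>x\<in>pts X. a)"
      by (intro extensionalityI[where A = "pts X"]) (auto simp: equivariant_def PiE_iff)
  qed (use that in \<open>auto simp: equivariant_def right_msetD\<close>)
  show "terminal (PSh S M) (fobj Delta_fun T)"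
    unfolding terminal_def a using universe_singleton[OF assms, of a] right_mset_Delta[of M "{a}"] hom
    by simp
qed

text \<open>The embedding \<open>e\<close> codes the carrier as a small set, so that the regular
  \<open>M\<close>-set becomes an object of \<open>PSh S M\<close>.\<close>

locale small_monoid = monoid M for M :: "('m, 'z) monoid_scheme" (structure) +
  fixes S :: "'u set set" and e :: "'m \<Rightarrow> 'u"
  assumes universe: "set_universe S"
    and inj_e: "inj_on e (carrier M)"
    and small: "e ` carrier M \<in> S"
begin

abbreviation reg :: "('u, 'm) rset" where
  "reg \<equiv> transport e (regular M)"

lemma pts_reg: "pts reg = e ` carrier M"
  by (simp add: regular_def)

lemma act_reg: "m \<in> carrier M \<Longrightarrow> act reg (e m) n = e (m \<otimes> n)"
  using act_transport[of e "regular M" m n] inj_e by (simp add: regular_def)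

lemma right_mset_reg: "right_mset M reg"
  by (rule right_mset_transport[OF right_mset_regular[OF monoid_axioms]])
    (simp add: regular_def inj_e)

lemma reg_obj: "reg \<in> Obj (PSh S M)"
  using right_mset_reg small pts_reg by (simp del: pts_transport)

lemma one_reg: "e \<one> \<in> pts reg"
  by (simp add: pts_reg del: pts_transport)

lemma fixed_reg: "x \<in> fixed_points M reg \<longleftrightarrow>
    (\<exists>l\<in>carrier M. x = e l \<and> (\<forall>n\<in>carrier M. l \<otimes> n = l))"
proof -
  have "e (l \<otimes> n) = e l \<longleftrightarrow> l \<otimes> n = l" if "l \<in> carrier M" "n \<in> carrier M" for l n
    using that inj_onD[OF inj_e] by auto
  then show ?thesis
    by (auto simp: fixed_points_def pts_reg act_reg simp del: pts_transport)
qed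

text \<open>The regular \<open>M\<close>-set is generated by \<open>e \<one>\<close>: each point is
  \<open>e \<one>\<close> acted on by some \<open>m\<close>. Hence it is connected.\<close>

lemma invariant_reg:
  assumes "\<And>x m. x \<in> pts reg \<Longrightarrow> m \<in> carrier M \<Longrightarrow> g (act reg x m) = g x" "x \<in> pts reg"
  shows "g x = g (e \<one>)"
proof -
  obtain m where m: "m \<in> carrier M" "x = e m"
    using assms(2) by (auto simp: pts_reg simp del: pts_transport)
  then have "x = act reg (e \<one>) m"
    by (simp add: act_reg)
  then show ?thesis using assms(1)[OF one_reg m(1)] by simp
qed

lemma cls_reg: "x \<in> pts reg \<Longrightarrow> cls M reg x = cls M reg (e \<one>)"
  by (rule invariant_reg) (rule cls_act[OF right_mset_reg])

lemma components_reg: "components M reg = {cls M reg (e \<one>)}"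
proof -
  have "components M reg = (\<lambda>_. cls M reg (e \<one>)) ` pts reg"
    unfolding components_def by (rule image_cong[OF refl cls_reg])
  then show ?thesis using one_reg by (simp add: image_constant)
qed

text \<open>Existence and uniqueness of a left zero are kept apart because different conditions
  supply them: epic \<open>\<alpha>\<close> or locality gives existence, while monic
  \<open>\<alpha>\<close>, preserved monomorphisms or preserved powers give uniqueness.\<close>

lemma has_zeroI:
  assumes "fixed_points M reg \<noteq> {}"
    and eq: "\<And>x y. x \<in> fixed_points M reg \<Longrightarrow> y \<in> fixed_points M reg \<Longrightarrow> x = y"
  shows "has_zero M"
proof -
  obtain x where "x \<in> fixed_points M reg"
    using assms(1) by blast
  then obtain l where l: "l \<in> carrier M" "\<And>n. n \<in> carrier M \<Longrightarrow> l \<otimes> n = l"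
    unfolding fixed_reg by blast
  have "n \<otimes> l = l" if n: "n \<in> carrier M" for n
  proof -
    have "e (n \<otimes> l) \<in> fixed_points M reg"
      unfolding fixed_reg using l n by (intro bexI[of _ "n \<otimes> l"]) (simp_all add: m_assoc)
    moreover have "e l \<in> fixed_points M reg"
      unfolding fixed_reg using l by auto
    ultimately have "e (n \<otimes> l) = e l" by (rule eq)
    then show ?thesis using inj_onD[OF inj_e] l n by auto
  qed
  then show ?thesis
    using l unfolding has_zero_def by blast
qed

section \<open>Conditions forcing a zero element\<close>

text \<open>Fullness extends any function from the fixed points of \<open>reg\<close> to a small set
  \<open>A\<close> to an equivariant map from \<open>reg\<close> to the trivial \<open>M\<close>-set
  on \<open>A\<close>, which is constant by connectedness. Taking \<open>A\<close> empty gives a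
  fixed point; taking two values shows that two fixed points cannot be separated.\<close>

lemma full_imp_zero:
  assumes "full (PSh S M) (SET S) (Gamma_fun M)"
  shows "has_zero M"
proof (rule has_zeroI)
  have lift: "\<exists>f\<in>equivariant M reg (fobj Delta_fun A). restrict f (fixed_points M reg) = g"
    if "A \<in> S" "g \<in> fixed_points M reg \<rightarrow>\<^sub>E A" for A :: "'u set" and g
  proof -
    have "fobj Delta_fun A \<in> Obj (PSh S M)"
      using that(1) right_mset_Delta by simp
    moreover have
      "g \<in> Hom (SET S) (fobj (Gamma_fun M) reg) (fobj (Gamma_fun M) (fobj Delta_fun A))"
      using that(2) fixed_points_Delta[of M A] by simp
    ultimately have "\<exists>f\<in>Hom (PSh S M) reg (fobj Delta_fun A).
        fmap (Gamma_fun M) reg (fobj Delta_fun A) f = g"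
      using assms reg_obj unfolding full_def by blast
    then show ?thesis by simp
  qed
  show "fixed_points M reg \<noteq> {}"
  proof
    assume "fixed_points M reg = {}"
    \<comment> \<open>The everywhere \<open>undefined\<close> function is the extensional map from
      the empty set to itself; its extension would send \<open>e \<one>\<close> into the empty
      set.\<close>
    then obtain f where f: "f \<in> equivariant M reg (fobj Delta_fun ({} :: 'u set))"
      using lift[OF universe_empty[OF universe], of "\<lambda>_. undefined"] by auto
    show False
      using equivariantD(2)[OF f one_reg] by simp
  qed
  fix x y assume x: "x \<in> fixed_points M reg" and y: "y \<in> fixed_points M reg"
  show "x = y"
  proof (rule ccontr)
    assume "x \<noteq> y"
    obtain a b :: 'u where ab: "a \<noteq> b"
      using universe_two_elements[OF universe] .
    obtain f where f: "f \<in> equivariant M reg (fobj Delta_fun {a, b})"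
      "restrict f (fixed_points M reg) = (\<lambda>t\<in>fixed_points M reg. if t = x then a else b)"
      using lift[OF universe_doubleton[OF universe],
          of "\<lambda>t\<in>fixed_points M reg. if t = x then a else b" a b] by auto
    have "f t = f (e \<one>)" if "t \<in> pts reg" for t
      by (rule invariant_reg[OF _ that]) (use equivariantD(3)[OF f(1)] in simp)
    then have "f x = f y"
      using fixed_pts[OF x] fixed_pts[OF y] by (simp del: pts_transport)
    moreover have "f x = a" "f y = b"
      using fun_cong[OF f(2), of x] fun_cong[OF f(2), of y] x y \<open>x \<noteq> y\<close> by auto
    ultimately show False using ab by simp
  qed
qed

text \<open>At \<open>reg\<close> the retraction starts from a one-point set. Its single value is a
  fixed point, and the retraction law makes every fixed point equal to it.\<close>

lemma split_monic_alpha_imp_zero: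
  assumes "split_monic (functor_cat (PSh S M) (SET S)) (Gamma_fun M) (C_fun M) (alpha S M)"
  shows "has_zero M"
proof -
  obtain r where r: "r \<in> Hom (functor_cat (PSh S M) (SET S)) (C_fun M) (Gamma_fun M)"
    and ret: "Comp (functor_cat (PSh S M) (SET S)) (Gamma_fun M) (C_fun M) (Gamma_fun M) r (alpha S M)
      = Ident (functor_cat (PSh S M) (SET S)) (Gamma_fun M)"
    using assms unfolding split_monic_def by blast
  have r_reg: "r reg \<in> components M reg \<rightarrow>\<^sub>E fixed_points M reg"
    using r reg_obj by (simp add: functor_cat_def natural_def del: PSh_simps)
  have r_cls: "r reg (cls M reg x) = x" if "x \<in> fixed_points M reg" for x
    using fun_cong[OF fun_cong[OF ret, of reg], of x] reg_obj that
    by (simp add: functor_cat_def alpha_def compose_def del: PSh_simps)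
  have "x = r reg (cls M reg (e \<one>))" if "x \<in> fixed_points M reg" for x
    using r_cls[OF that] unfolding cls_reg[OF fixed_pts[OF that]] by simp
  moreover have "r reg (cls M reg (e \<one>)) \<in> fixed_points M reg"
    using r_reg components_reg by auto
  ultimately show ?thesis
    by (intro has_zeroI) auto
qed

lemma monic_alpha_imp_fixed_unique:
  assumes mono: "monic (functor_cat (PSh S M) (SET S)) (Gamma_fun M) (C_fun M) (alpha S M)"
    and x: "x \<in> fixed_points M reg" and y: "y \<in> fixed_points M reg"
  shows "x = y"
proof -
  text \<open>A left zero \<open>l\<close> gives a natural map \<open>u \<mapsto> u l\<close> from the underlying set of \<open>X\<close> to its
    fixed points; composed with \<open>\<alpha>\<close> it sends \<open>u\<close> to its component, whatever \<open>l\<close> is.\<close>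
  define U :: "(('u, 'm) rset, 'u \<Rightarrow> 'u, 'u set, 'u \<Rightarrow> 'u) functr"
    where "U = \<lparr> fobj = pts, fmap = (\<lambda>X Y f. f) \<rparr>"
  define \<eta> :: "'m \<Rightarrow> ('u, 'm) rset \<Rightarrow> 'u \<Rightarrow> 'u"
    where "\<eta> = (\<lambda>l. \<lambda>X\<in>Obj (PSh S M). \<lambda>u\<in>pts X. act X u l)"
  have U: "is_functor (PSh S M) (SET S) U"
    by (auto simp: is_functor_def U_def equivariantD)
  have \<eta>: "\<eta> l \<in> Hom (functor_cat (PSh S M) (SET S)) U (Gamma_fun M)"
    and \<alpha>\<eta>: "Comp (functor_cat (PSh S M) (SET S)) U (Gamma_fun M) (C_fun M) (alpha S M) (\<eta> l) =
      (\<lambda>X\<in>Obj (PSh S M). \<lambda>u\<in>pts X. cls M X u)"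
    if l: "l \<in> carrier M" "\<forall>n\<in>carrier M. l \<otimes> n = l" for l
  proof -
    have fixed: "act X u l \<in> fixed_points M X" if "right_mset M X" "u \<in> pts X"
      for X :: "('u, 'm) rset" and u
      unfolding fixed_points_def using that l by (auto simp: right_msetD simp flip: right_msetD(3))
    have "natural (PSh S M) (SET S) U (Gamma_fun M) (\<eta> l)"
      unfolding natural_def
    proof (intro conjI ballI)
      fix X Y f assume "X \<in> Obj (PSh S M)" "Y \<in> Obj (PSh S M)" "f \<in> Hom (PSh S M) X Y"
      then show "Comp (SET S) (fobj U X) (fobj U Y) (fobj (Gamma_fun M) Y) (\<eta> l Y) (fmap U X Y f) =
          Comp (SET S) (fobj U X) (fobj (Gamma_fun M) X) (fobj (Gamma_fun M) Y)
            (fmap (Gamma_fun M) X Y f) (\<eta> l X)"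
        by (auto simp: U_def \<eta>_def fun_eq_iff compose_def fixed equivariantD l(1))
    qed (auto simp: U_def \<eta>_def fixed)
    then show "\<eta> l \<in> Hom (functor_cat (PSh S M) (SET S)) U (Gamma_fun M)"
      by (simp add: functor_cat_def \<eta>_def)
    show "Comp (functor_cat (PSh S M) (SET S)) U (Gamma_fun M) (C_fun M) (alpha S M) (\<eta> l) =
        (\<lambda>X\<in>Obj (PSh S M). \<lambda>u\<in>pts X. cls M X u)"
      by (auto simp: functor_cat_def U_def \<eta>_def alpha_def fun_eq_iff compose_def fixed cls_act l(1))
  qed
  obtain l where l: "l \<in> carrier M" "x = e l" "\<forall>n\<in>carrier M. l \<otimes> n = l"
    using x unfolding fixed_reg by blast
  obtain l' where l': "l' \<in> carrier M" "y = e l'" "\<forall>n\<in>carrier M. l' \<otimes> n = l'"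
    using y unfolding fixed_reg by blast
  have "U \<in> Obj (functor_cat (PSh S M) (SET S))"
    using U by (simp add: functor_cat_def)
  then have "\<eta> l = \<eta> l'"
    using mono \<eta>[OF l(1,3)] \<eta>[OF l'(1,3)] \<alpha>\<eta>[OF l(1,3)] \<alpha>\<eta>[OF l'(1,3)]
    unfolding monic_def by simp
  \<comment> \<open>As in the Yoneda lemma, evaluation at the identity recovers the left zero:
    \<open>\<eta> l reg (e \<one>) = e l\<close>.\<close>
  then have "\<eta> l reg (e \<one>) = \<eta> l' reg (e \<one>)"
    by simp
  then show ?thesis
    using reg_obj one_reg l l' by (simp add: \<eta>_def act_reg del: PSh_simps pts_transport)
qed

lemma epic_alpha_imp_fixed:
  assumes epi: "epic (functor_cat (PSh S M) (SET S)) (Gamma_fun M) (C_fun M) (alpha S M)"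
  shows "fixed_points M reg \<noteq> {}"
proof
  assume no_fixed: "fixed_points M reg = {}"
  obtain a b :: 'u where ab: "a \<noteq> b"
    using universe_two_elements[OF universe] .
  text \<open>The two maps into \<open>Z\<close> below agree on every \<open>X\<close> that has a fixed point, and hence after
    composition with \<open>\<alpha>\<close>, since its domain is empty at the other \<open>X\<close>.\<close>
  define Z :: "(('u, 'm) rset, 'u \<Rightarrow> 'u, 'u set, 'u \<Rightarrow> 'u) functr"
    where "Z = \<lparr> fobj = (\<lambda>X. if fixed_points M X = {} then {a, b} else {a}),
      fmap = (\<lambda>X Y f. \<lambda>t\<in>if fixed_points M X = {} then {a, b} else {a}.
        if fixed_points M Y = {} then t else a) \<rparr>"
  define \<eta> :: "'u \<Rightarrow> ('u, 'm) rset \<Rightarrow> 'u \<Rightarrow> 'u"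
    where "\<eta> = (\<lambda>t. \<lambda>X\<in>Obj (PSh S M). \<lambda>c\<in>components M X. if fixed_points M X = {} then t else a)"
  \<comment> \<open>Lacking fixed points is inherited by the domain of a map, so
    \<open>fmap Z\<close> never has to lead from \<open>{a}\<close> back to \<open>{a, b}\<close>;
    this makes \<open>Z\<close> a functor.\<close>
  have fixed_mono: "fixed_points M X = {}"
    if "f \<in> equivariant M X Y" "fixed_points M Y = {}" for X Y :: "('u, 'm) rset" and f
    using fixed_map[OF that(1)] that(2) by blast
  have Z: "is_functor (PSh S M) (SET S) Z"
    unfolding is_functor_def
  proof (intro conjI ballI)
    fix X Y W f g
    assume "f \<in> Hom (PSh S M) X Y" "g \<in> Hom (PSh S M) Y W"
    then have "fixed_points M Y = {} \<Longrightarrow> fixed_points M X = {}"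
      "fixed_points M W = {} \<Longrightarrow> fixed_points M Y = {}"
      using fixed_mono by auto
    then show "fmap Z X W (Comp (PSh S M) X Y W g f) =
        Comp (SET S) (fobj Z X) (fobj Z Y) (fobj Z W) (fmap Z Y W g) (fmap Z X Y f)"
      by (auto simp: Z_def fun_eq_iff compose_def)
  qed (auto simp: Z_def fun_eq_iff universe_singleton[OF universe] universe_doubleton[OF universe])
  have \<eta>: "\<eta> t \<in> Hom (functor_cat (PSh S M) (SET S)) (C_fun M) Z" if t: "t \<in> {a, b}" for t
  proof -
    have "natural (PSh S M) (SET S) (C_fun M) Z (\<eta> t)"
      unfolding natural_def
    proof (intro conjI ballI)
      fix X Y f assume XY: "X \<in> Obj (PSh S M)" "Y \<in> Obj (PSh S M)" "f \<in> Hom (PSh S M) X Y"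
      then have "fixed_points M Y = {} \<Longrightarrow> fixed_points M X = {}"
        using fixed_mono by auto
      then show "Comp (SET S) (fobj (C_fun M) X) (fobj (C_fun M) Y) (fobj Z Y) (\<eta> t Y)
            (fmap (C_fun M) X Y f) =
          Comp (SET S) (fobj (C_fun M) X) (fobj Z X) (fobj Z Y) (fmap Z X Y f) (\<eta> t X)"
        using XY t by (auto simp: Z_def \<eta>_def fun_eq_iff compose_def cls_in_components
            component_pts equivariantD)
    qed (use t in \<open>auto simp: Z_def \<eta>_def\<close>)
    then show ?thesis by (simp add: functor_cat_def \<eta>_def)
  qed
  have "Comp (functor_cat (PSh S M) (SET S)) (Gamma_fun M) (C_fun M) Z (\<eta> a) (alpha S M) =
      Comp (functor_cat (PSh S M) (SET S)) (Gamma_fun M) (C_fun M) Z (\<eta> b) (alpha S M)"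
    by (auto simp: functor_cat_def \<eta>_def alpha_def fun_eq_iff compose_def cls_in_components
        fixed_pts)
  moreover have "Z \<in> Obj (functor_cat (PSh S M) (SET S))"
    using Z by (simp add: functor_cat_def)
  ultimately have "\<eta> a = \<eta> b"
    using epi \<eta> unfolding epic_def by blast
  \<comment> \<open>\<open>reg\<close> has a component but no fixed point, so there the two maps
    take the distinct values \<open>a\<close> and \<open>b\<close>.\<close>
  then have "\<eta> a reg (cls M reg (e \<one>)) = \<eta> b reg (cls M reg (e \<one>))"
    by simp
  then show False
    using reg_obj ab no_fixed components_reg by (simp add: \<eta>_def del: PSh_simps)
qed

section \<open>Locality, preserved monomorphisms and a left adjoint of
  \<open>C_fun M\<close>\<close>

lemma local_imp_fixed:
  assumes "is_local S M"
  shows "fixed_points M reg \<noteq> {}"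
proof
  assume no_fixed: "fixed_points M reg = {}"
  obtain R where "adjoint (PSh S M) (SET S) (Gamma_fun M) R"
    using assms by (auto simp: is_local_def)
  then obtain \<phi> where \<phi>: "\<forall>X\<in>Obj (PSh S M). \<forall>A\<in>Obj (SET S).
      bij_betw (\<phi> X A) (Hom (SET S) (fobj (Gamma_fun M) X) A) (Hom (PSh S M) X (fobj R A))"
    and R: "is_functor (SET S) (PSh S M) R"
    unfolding adjoint_def by (elim conjE exE) (rule that)
  obtain a b :: 'u where ab: "a \<noteq> b"
    using universe_two_elements[OF universe] .
  let ?A = "{a, b}" and ?T = "fobj Delta_fun {a} :: ('u, 'm) rset"
  have A: "?A \<in> Obj (SET S)"
    using universe_doubleton[OF universe] by simp
  have T: "?T \<in> Obj (PSh S M)"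
    using universe_singleton[OF universe] right_mset_Delta[of M "{a}"] by simp
  have RA: "right_mset M (fobj R ?A)"
    using R A by (auto simp: is_functor_def)
  \<comment> \<open>Without fixed points \<open>reg\<close> has empty global sections, and the empty
    set has exactly one map to \<open>?A\<close>; by transposition \<open>reg\<close> has exactly
    one map to \<open>R ?A\<close>.\<close>
  have "bij_betw (\<phi> reg ?A) ({} \<rightarrow>\<^sub>E ?A) (equivariant M reg (fobj R ?A))"
    using bspec[OF bspec[OF \<phi> reg_obj] A] unfolding SET_simps PSh_simps fobj_simps no_fixed .
  then obtain g where only_g: "equivariant M reg (fobj R ?A) = {g}"
    unfolding bij_betw_def by auto
  text \<open>By freeness of the regular \<open>M\<close>-set, \<open>R A\<close> has at most one point.\<close>
  have RA_point: "p = q" if p: "p \<in> pts (fobj R ?A)" and q: "q \<in> pts (fobj R ?A)" for p q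
  proof -
    let ?f = "\<lambda>p. \<lambda>x\<in>e ` carrier M. act (fobj R ?A) p (inv_into (carrier M) e x)"
    have f: "?f p \<in> equivariant M reg (fobj R ?A)" if "p \<in> pts (fobj R ?A)" for p
      using that by (auto simp: equivariant_def pts_reg act_reg inj_e right_msetD[OF RA]
          simp del: pts_transport)
    have "?f p = ?f q"
      using f[OF p] f[OF q] unfolding only_g by simp
    then have "?f p (e \<one>) = ?f q (e \<one>)" by simp
    then show ?thesis
      using p q by (simp add: inj_e right_msetD[OF RA])
  qed
  \<comment> \<open>The one-point \<open>?T\<close> has one fixed point, so two different maps to
    \<open>?A\<close> must transpose injectively into the maps from \<open>?T\<close> to
    \<open>R ?A\<close>, of which there is at most one.\<close>
  have "bij_betw (\<phi> ?T ?A) ({a} \<rightarrow>\<^sub>E ?A) (equivariant M ?T (fobj R ?A))"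
    using bspec[OF bspec[OF \<phi> T] A] fixed_points_Delta[of M "{a}"]
    unfolding SET_simps PSh_simps fobj_simps by simp
  then have inj: "inj_on (\<phi> ?T ?A) ({a} \<rightarrow>\<^sub>E ?A)"
    and maps: "\<phi> ?T ?A ` ({a} \<rightarrow>\<^sub>E ?A) = equivariant M ?T (fobj R ?A)"
    by (auto simp: bij_betw_def)
  have unique: "g = h"
    if "g \<in> equivariant M ?T (fobj R ?A)" "h \<in> equivariant M ?T (fobj R ?A)" for g h
  proof (rule PiE_ext[OF equivariantD(1)[OF that(1)] equivariantD(1)[OF that(2)]])
    fix t assume "t \<in> pts ?T"
    then show "g t = h t"
      using RA_point equivariantD(2)[OF that(1)] equivariantD(2)[OF that(2)] by blast
  qed
  let ?k = "\<lambda>t. \<lambda>s\<in>{a}. t"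
  have k: "?k a \<in> {a} \<rightarrow>\<^sub>E ?A" "?k b \<in> {a} \<rightarrow>\<^sub>E ?A" by auto
  then have "\<phi> ?T ?A (?k a) = \<phi> ?T ?A (?k b)"
    by (intro unique) (simp_all only: maps[symmetric] imageI)
  then have "?k a = ?k b"
    by (rule inj_onD[OF inj _ k])
  then have "?k a a = ?k b a" by (rule fun_cong)
  then show False using ab by simp
qed

text \<open>The fixed points of \<open>reg\<close> form a trivial sub-\<open>M\<close>-set. Its
  inclusion is monic, but on components it maps all fixed points to the single component of
  \<open>reg\<close>.\<close>

lemma preserves_monos_imp_fixed_unique:
  assumes mono: "preserves_monos (PSh S M) (SET S) (C_fun M)"
    and x: "x \<in> fixed_points M reg" and y: "y \<in> fixed_points M reg"
  shows "x = y"
proof -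
  let ?F = "fobj Delta_fun (fixed_points M reg) :: ('u, 'm) rset"
  let ?i = "\<lambda>x\<in>fixed_points M reg. x"
  have F: "right_mset M ?F" by (rule right_mset_Delta)
  have "fixed_points M reg \<in> S"
    using universe_subset[OF universe small] fixed_subset[of M reg] unfolding pts_reg .
  then have F_obj: "?F \<in> Obj (PSh S M)"
    using F by simp
  have "?i \<in> equivariant M ?F reg"
    unfolding equivariant_def by (auto simp: fixed_points_def simp del: pts_transport)
  then have "monic (PSh S M) ?F reg ?i"
    using F_obj reg_obj by (intro monic_PSh) (auto simp: inj_on_def)
  then have "monic (SET S) (fobj (C_fun M) ?F) (fobj (C_fun M) reg) (fmap (C_fun M) ?F reg ?i)"
    using mono unfolding preserves_monos_def by blast
  then have "inj_on (fmap (C_fun M) ?F reg ?i) (components M ?F)"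
    using monic_SET_inj[OF universe] by fastforce
  \<comment> \<open>On a trivial \<open>M\<close>-set the identity function is invariant, so every
    point is the chosen representative of its own component.\<close>
  moreover have component: "t \<in> components M ?F" if "t \<in> fixed_points M reg" for t
  proof -
    have "cls M ?F t = t"
      by (rule cls_factor[OF F, where g = "\<lambda>t. t"]) (simp_all add: that)
    then show ?thesis
      using cls_in_components[of t ?F M] that by simp
  qed
  moreover have "fmap (C_fun M) ?F reg ?i t = cls M reg (e \<one>)" if "t \<in> fixed_points M reg" for t
    using component[OF that] that cls_reg[OF fixed_pts[OF that]] by simp
  ultimately show ?thesis
    using x y by (metis inj_onD)
qed

text \<open>\<open>L\<close> sends a singleton to a terminal, hence one-point, \<open>M\<close>-set,
  whose maps to \<open>reg\<close> are the fixed points of \<open>reg\<close>. By adjunction they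
  correspond to the components of \<open>reg\<close>, of which there is one.\<close>

lemma left_adjoint_C_imp_zero:
  assumes adj: "adjoint (SET S) (PSh S M) L (C_fun M)"
    and L: "preserves_terminal (SET S) (PSh S M) L"
  shows "has_zero M"
proof -
  obtain \<phi> where \<phi>: "\<forall>A\<in>Obj (SET S). \<forall>X\<in>Obj (PSh S M).
      bij_betw (\<phi> A X) (Hom (PSh S M) (fobj L A) X) (Hom (SET S) A (fobj (C_fun M) X))"
    using adj unfolding adjoint_def by (elim conjE exE) (rule that)
  fix a :: 'u
  have A: "{a} \<in> Obj (SET S)"
    using universe_singleton[OF universe] by simp
  have "terminal (SET S) {a}"
    unfolding terminal_def
  proof (intro conjI A ballI ex1I)
    fix B show "(\<lambda>x\<in>B. a) \<in> Hom (SET S) B {a}" by simp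
    fix f assume "f \<in> Hom (SET S) B {a}"
    then show "f = (\<lambda>x\<in>B. a)"
      by (intro extensionalityI[where A = B]) (auto simp: PiE_iff)
  qed
  then have T_terminal: "terminal (PSh S M) (fobj L {a})"
    using L unfolding preserves_terminal_def by blast
  let ?T = "fobj L {a}" and ?P = "fobj Delta_fun {a} :: ('u, 'm) rset"
  have P: "?P \<in> Obj (PSh S M)"
    using A right_mset_Delta[of M "{a}"] by simp
  have T: "?T \<in> Obj (PSh S M)"
    using T_terminal by (simp add: terminal_def)
  have unique: "\<exists>!f. f \<in> equivariant M X ?T" if "X \<in> Obj (PSh S M)" for X
    using T_terminal that unfolding terminal_def PSh_simps(2) by blast
  then obtain p where p: "p \<in> equivariant M ?P ?T"
    using P by blast
  have "a \<in> fixed_points M ?P"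
    unfolding fixed_points_Delta by simp
  then have fixed_p: "p a \<in> fixed_points M ?T"
    by (rule fixed_map[OF p])
  \<comment> \<open>A terminal object has one endomorphism, so the identity of \<open>?T\<close> is
    the constant map at the fixed point \<open>p a\<close>.\<close>
  have "f = (\<lambda>t\<in>pts ?T. p a)" if "f \<in> equivariant M ?T ?T" for f
  proof -
    have "(\<lambda>t\<in>pts ?T. p a) \<in> equivariant M ?T ?T"
      using fixed_p T by (auto simp: equivariant_def fixed_points_def right_msetD)
    then show ?thesis
      using unique[OF T] that by blast
  qed
  then have id_const: "(\<lambda>t\<in>pts ?T. t) = (\<lambda>t\<in>pts ?T. p a)"
    using equivariant_id T by auto
  have "t = p a" if "t \<in> pts ?T" for t
    using fun_cong[OF id_const, of t] that by simp
  then have pts_T: "pts ?T = {p a}"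
    using fixed_pts[OF fixed_p] by blast
  let ?H = "equivariant M ?T reg"
  have bij: "bij_betw (\<phi> {a} reg) ?H ({a} \<rightarrow>\<^sub>E {cls M reg (e \<one>)})"
    using bspec[OF bspec[OF \<phi> A] reg_obj] unfolding SET_simps PSh_simps fobj_simps components_reg .
  have const: "(\<lambda>t\<in>pts ?T. x) \<in> ?H" if "x \<in> fixed_points M reg" for x
    using that T by (auto simp: equivariant_def fixed_points_def right_msetD simp del: pts_transport)
  show ?thesis
  proof (rule has_zeroI)
    \<comment> \<open>Surjectivity of the transposition yields a fixed point of \<open>reg\<close>;
      injectivity, further down, its uniqueness.\<close>
    have "(\<lambda>s\<in>{a}. cls M reg (e \<one>)) \<in> \<phi> {a} reg ` ?H"
      unfolding bij_betw_imp_surj_on[OF bij] by simp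
    then obtain h where h: "h \<in> ?H"
      by blast
    show "fixed_points M reg \<noteq> {}"
      using fixed_map[OF h fixed_p] by blast
    fix x y assume x: "x \<in> fixed_points M reg" and y: "y \<in> fixed_points M reg"
    have "\<phi> {a} reg (\<lambda>t\<in>pts ?T. x) = \<phi> {a} reg (\<lambda>t\<in>pts ?T. y)"
    proof (rule PiE_ext)
      show x': "\<phi> {a} reg (\<lambda>t\<in>pts ?T. x) \<in> {a} \<rightarrow>\<^sub>E {cls M reg (e \<one>)}"
        and y': "\<phi> {a} reg (\<lambda>t\<in>pts ?T. y) \<in> {a} \<rightarrow>\<^sub>E {cls M reg (e \<one>)}"
        by (rule bij_betw_apply[OF bij const[OF x]] bij_betw_apply[OF bij const[OF y]])+
      fix s assume s: "s \<in> {a}"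
      show "\<phi> {a} reg (\<lambda>t\<in>pts ?T. x) s = \<phi> {a} reg (\<lambda>t\<in>pts ?T. y) s"
        using PiE_mem[OF x' s] PiE_mem[OF y' s] by simp
    qed
    then have "(\<lambda>t\<in>pts ?T. x) = (\<lambda>t\<in>pts ?T. y)"
      by (rule inj_onD[OF bij_betw_imp_inj_on[OF bij] _ const[OF x] const[OF y]])
    then have "(\<lambda>t\<in>pts ?T. x) (p a) = (\<lambda>t\<in>pts ?T. y) (p a)"
      by (rule fun_cong)
    then show "x = y"
      unfolding pts_T by simp
  qed
qed

section \<open>Preservation of powers: a chain with unbounded zigzag distances\<close>

text \<open>Countably many copies of the regular \<open>M\<close>-set, the left zero \<open>y\<close> of each being glued to the
  left zero \<open>x\<close> of the next.\<close>

definition chain :: "'m \<Rightarrow> 'm \<Rightarrow> (nat \<times> 'm, 'm) rset" where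
  "chain x y = \<lparr> pts = UNIV \<times> (carrier M - {y}),
     act = (\<lambda>(k, m) n. if m \<otimes> n = y then (Suc k, x) else (k, m \<otimes> n)) \<rparr>"

text \<open>For associativity, a product that has reached \<open>y\<close> stays there, and the
  point \<open>(Suc k, x)\<close> reached by the jump is fixed because \<open>x \<noteq> y\<close>.
  So jumping after the first factor or after the whole product gives the same point.\<close>

lemma right_mset_chain:
  assumes "x \<in> carrier M" "x \<noteq> y" "\<And>n. n \<in> carrier M \<Longrightarrow> x \<otimes> n = x"
    "\<And>n. n \<in> carrier M \<Longrightarrow> y \<otimes> n = y"
  shows "right_mset M (chain x y)"
proof -
  have "m \<otimes> (n \<otimes> n') = y" if "m \<in> carrier M" "n \<in> carrier M" "n' \<in> carrier M" "m \<otimes> n = y" for m n n'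
    using that assms(4) by (simp flip: m_assoc)
  then show ?thesis
    using assms(1-3) by (auto simp: right_mset_def chain_def m_assoc)
qed

text \<open>One action step changes \<open>d\<close> by at most one in all coordinates
  simultaneously, and bounds add along zigzags. Being within a bound uniform in \<open>i\<close> is
  thus an equivalence relation containing the generating steps.\<close>

lemma conn_power_bounded:
  fixes d :: "'y \<Rightarrow> nat"
  assumes Y: "right_mset M Y"
    and d: "\<And>y m. y \<in> pts Y \<Longrightarrow> m \<in> carrier M \<Longrightarrow> d y \<le> d (act Y y m) \<and> d (act Y y m) \<le> Suc (d y)"
    and conn: "(f, g) \<in> conn M (power_rset I Y)"
  shows "\<exists>b. \<forall>i\<in>I. d (f i) \<le> d (g i) + b \<and> d (g i) \<le> d (f i) + b"
proof -
  let ?P = "pts (power_rset I Y)"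
  let ?B = "\<lambda>f g b. \<forall>i\<in>I. d (f i) \<le> d (g i) + b \<and> d (g i) \<le> d (f i) + b"
  have trans: "?B f h (b + c)" if "?B f g b" "?B g h c" for f g h b c
  proof
    fix i assume "i \<in> I"
    then have "d (f i) \<le> d (g i) + b \<and> d (g i) \<le> d (f i) + b"
      "d (g i) \<le> d (h i) + c \<and> d (h i) \<le> d (g i) + c"
      using that by auto
    then show "d (f i) \<le> d (h i) + (b + c) \<and> d (h i) \<le> d (f i) + (b + c)"
      by linarith
  qed
  let ?R = "{(f, g). f \<in> ?P \<and> g \<in> ?P \<and> (\<exists>b. ?B f g b)}"
  have "conn M (power_rset I Y) \<subseteq> ?R"
  proof (rule conn_least)
    have "refl_on ?P ?R"
      by (rule refl_onI) (auto intro: exI[of _ 0])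
    moreover have "?R \<subseteq> ?P \<times> ?P"
      by auto
    moreover have "sym ?R"
      by (rule symI) auto
    moreover have "trans ?R"
    proof (rule transI)
      fix f g h assume "(f, g) \<in> ?R" "(g, h) \<in> ?R"
      then obtain b c where "f \<in> ?P" "h \<in> ?P" "?B f g b" "?B g h c"
        by auto
      then show "(f, h) \<in> ?R"
        using trans[of f g b h c] by blast
    qed
    ultimately show "equiv ?P ?R"
      by (simp add: equiv_def)
    fix f m assume f: "f \<in> ?P" and m: "m \<in> carrier M"
    have "act (power_rset I Y) f m \<in> ?P"
      using right_msetD(1)[OF right_mset_power[OF Y] f m] .
    moreover have "?B f (act (power_rset I Y) f m) 1"
      using f m d by (auto simp: power_rset_def PiE_iff le_SucI)
    ultimately show "(f, act (power_rset I Y) f m) \<in> ?R"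
      using f by blast
  qed
  then show ?thesis
    using conn by auto
qed

text \<open>In the chain glued from two distinct left zeros, the family running through all copies
  and a constant family agree componentwise, yet their distance is unbounded, so they lie in
  different components of the power.\<close>

lemma preserves_powers_imp_fixed_unique:
  assumes pow: "C_preserves_powers S M"
    and x: "x \<in> fixed_points M reg" and y: "y \<in> fixed_points M reg"
  shows "x = y"
proof (rule ccontr)
  assume "x \<noteq> y"
  obtain l where l: "l \<in> carrier M" "x = e l" "\<And>n. n \<in> carrier M \<Longrightarrow> l \<otimes> n = l"
    using x unfolding fixed_reg by blast
  obtain r where r: "r \<in> carrier M" "y = e r" "\<And>n. n \<in> carrier M \<Longrightarrow> r \<otimes> n = r"
    using y unfolding fixed_reg by blast
  have lr: "l \<noteq> r"
    using \<open>x \<noteq> y\<close> l(2) r(2) by auto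
  \<comment> \<open>If \<open>\<one>\<close> were \<open>r\<close>, then
    \<open>l = \<one> l = r l = r\<close>. The inequality makes each \<open>(k, \<one>)\<close> a
    point of the chain.\<close>
  have one_r: "\<one> \<noteq> r"
    using r(3)[OF l(1)] l(1) lr by auto
  obtain \<iota> :: "nat \<Rightarrow> 'u" where \<iota>: "inj \<iota>" "range \<iota> \<in> S"
    using universe_nat[OF universe] .
  obtain j :: "nat \<times> 'm \<Rightarrow> 'u" where j: "inj_on j (UNIV \<times> carrier M)" "j ` (UNIV \<times> carrier M) \<in> S"
    using universe_times[OF universe \<iota> inj_e small] .
  let ?Q = "chain l r" and ?Y = "transport j (chain l r)"
  have Q: "right_mset M ?Q"
    using l(1) lr l(3) r(3) by (rule right_mset_chain)
  have sub: "pts ?Q \<subseteq> UNIV \<times> carrier M"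
    by (auto simp: chain_def)
  have inj_j: "inj_on j (pts ?Q)"
    using j(1) sub by (rule inj_on_subset)
  have Y: "right_mset M ?Y"
    using Q inj_j by (rule right_mset_transport)
  have "pts ?Y \<in> S"
    using universe_subset[OF universe j(2) image_mono[OF sub]] by simp
  then have Y_obj: "?Y \<in> Obj (PSh S M)"
    using Y by simp
  \<comment> \<open>\<open>d\<close> reads off the number of the copy; the action keeps it or raises
    it by one.\<close>
  define d where "d = (\<lambda>u. fst (inv_into (pts ?Q) j u))"
  have d_j: "d (j q) = fst q" if "q \<in> pts ?Q" for q
    using inv_into_f_f[OF inj_j that] by (simp add: d_def)
  have step: "d u \<le> d (act ?Y u m) \<and> d (act ?Y u m) \<le> Suc (d u)"
    if u: "u \<in> pts ?Y" and m: "m \<in> carrier M" for u m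
  proof -
    obtain q where q: "q \<in> pts ?Q" "u = j q"
      using u by auto
    have "act ?Y u m = j (act ?Q q m)"
      using q act_transport[OF inj_j] by simp
    moreover have "act ?Q q m \<in> pts ?Q"
      using right_msetD(1)[OF Q q(1) m] .
    moreover have "fst q \<le> fst (act ?Q q m) \<and> fst (act ?Q q m) \<le> Suc (fst q)"
      by (auto simp: chain_def split: prod.split)
    ultimately show ?thesis
      using d_j q by simp
  qed
  have kl: "(k, l) \<in> pts ?Q" and k1: "(k, \<one>) \<in> pts ?Q" for k
    using l(1) lr one_r by (auto simp: chain_def)
  have same_cls: "cls M ?Y (j (k, l)) = cls M ?Y (j (0, l))" for k
  proof (induction k)
    case (Suc k)
    have jk1: "j (k, \<one>) \<in> pts ?Y"
      using k1 by simp
    \<comment> \<open>The identity of copy \<open>k\<close> links both ends of that copy: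
      \<open>l\<close> leads to \<open>(k, l)\<close>, and \<open>r\<close> jumps to
      \<open>(Suc k, l)\<close>.\<close>
    have "act ?Y (j (k, \<one>)) r = j (Suc k, l)" "act ?Y (j (k, \<one>)) l = j (k, l)"
      using act_transport[OF inj_j k1] l(1) r(1) lr by (simp_all add: chain_def)
    then have "cls M ?Y (j (Suc k, l)) = cls M ?Y (j (k, l))"
      using cls_act[OF Y jk1 r(1)] cls_act[OF Y jk1 l(1)] by simp
    then show ?case using Suc by simp
  qed simp
  define I where "I = range \<iota>"
  define f where "f = (\<lambda>i\<in>I. j (the_inv \<iota> i, l))"
  define g where "g = (\<lambda>i\<in>I. j (0 :: nat, l))"
  let ?P = "power_rset I ?Y"
  have fg: "f \<in> I \<rightarrow>\<^sub>E pts ?Y" "g \<in> I \<rightarrow>\<^sub>E pts ?Y"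
    using kl by (auto simp: f_def g_def)
  then have fgP: "f \<in> pts ?P" "g \<in> pts ?P"
    by (simp_all add: power_rset_def)
  have "inj_on (\<lambda>y. \<lambda>i\<in>I. cls M ?Y (y i)) (components M ?P)"
    using pow \<iota>(2) Y_obj unfolding C_preserves_powers_def I_def bij_betw_def by blast
  moreover have "(\<lambda>i\<in>I. cls M ?Y (cls M ?P f i)) = (\<lambda>i\<in>I. cls M ?Y (cls M ?P g i))"
    unfolding power_cls[OF Y fg(1)] power_cls[OF Y fg(2)]
    using same_cls by (auto simp: f_def g_def)
  ultimately have "cls M ?P f = cls M ?P g"
    using cls_in_components[OF fgP(1)] cls_in_components[OF fgP(2)] by (rule inj_onD)
  then have "(f, g) \<in> conn M ?P"
    using cls_eq_iff[OF right_mset_power[OF Y] fgP] by simp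
  from conn_power_bounded[OF Y step this] obtain b where b: "\<forall>i\<in>I. d (f i) \<le> d (g i) + b"
    by blast
  \<comment> \<open>The coordinate \<open>Suc b\<close> is the first to violate the bound
    \<open>b\<close> between \<open>f\<close> and \<open>g\<close>.\<close>
  have i: "\<iota> (Suc b) \<in> I"
    by (simp add: I_def)
  have "d (f (\<iota> (Suc b))) = Suc b" "d (g (\<iota> (Suc b))) = 0"
    using i d_j[OF kl] by (simp_all add: f_def g_def the_inv_f_f[OF \<iota>(1)])
  then show False
    using bspec[OF b i] by simp
qed

end

section \<open>Assembly of the equivalences, each through \<open>has_zero M\<close>\<close>

theorem theorem2p59:
  fixes S :: "'u set set" and M :: "('m, 'z) monoid_scheme"
  assumes "set_universe S"
    and "monoid M"
    and "\<exists>e :: 'm \<Rightarrow> 'u. inj_on e (carrier M) \<and> e ` carrier M \<in> S"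
  shows
    "(has_zero M \<longleftrightarrow> full (PSh S M) (SET S) (Gamma_fun M)) \<and>
     (has_zero M \<longleftrightarrow>
        split_monic (functor_cat (PSh S M) (SET S)) (Gamma_fun M) (C_fun M) (alpha S M)) \<and>
     (has_zero M \<longleftrightarrow>
        isomorphism (functor_cat (PSh S M) (SET S)) (Gamma_fun M) (C_fun M) (alpha S M)) \<and>
     (has_zero M \<longleftrightarrow> bipunctually_locally_connected S M) \<and>
     (has_zero M \<longleftrightarrow> is_bilocal S M) \<and>
     (has_zero M \<longleftrightarrow>
        epic (functor_cat (PSh S M) (SET S)) (Gamma_fun M) (C_fun M) (alpha S M) \<and>
        C_preserves_powers S M) \<and>
     (has_zero M \<longleftrightarrow> is_local S M \<and> preserves_monos (PSh S M) (SET S) (C_fun M)) \<and>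
     (has_zero M \<longleftrightarrow>
        (\<exists>L. adjoint (SET S) (PSh S M) L (C_fun M) \<and>
             preserves_terminal (SET S) (PSh S M) L))"
proof -
  let ?F = "functor_cat (PSh S M) (SET S)"
  obtain e :: "'m \<Rightarrow> 'u" where e: "inj_on e (carrier M)" "e ` carrier M \<in> S"
    using assms(3) by blast
  interpret small_monoid M S e
    by (rule small_monoid.intro[OF assms(2)], unfold_locales) (use assms(1) e in auto)
  \<comment> \<open>Colocality makes \<open>C_fun M\<close> a right adjoint, which reduces
    bilocality to locality with preserved monomorphisms.\<close>
  have C_monos: "preserves_monos (PSh S M) (SET S) (C_fun M)"
    if "is_colocal S M"
    using that right_adjoint_preserves_monos[OF _ category_SET category_PSh]
    unfolding is_colocal_def by blast
  have local_monos: "has_zero M" if "is_local S M" "preserves_monos (PSh S M) (SET S) (C_fun M)"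
    using local_imp_fixed[OF that(1)] preserves_monos_imp_fixed_unique[OF that(2)]
    by (rule has_zeroI)
  have split: "has_zero M"
    if "isomorphism ?F (Gamma_fun M) (C_fun M) (alpha S M)"
    using that by (rule split_monic_alpha_imp_zero[OF isomorphism_imp_split_monic])
  have bipunctual: "has_zero M" if "bipunctually_locally_connected S M"
    using that unfolding bipunctually_locally_connected_def punctually_locally_connected_def
      copunctually_locally_connected_def
    by (metis has_zeroI epic_alpha_imp_fixed monic_alpha_imp_fixed_unique)
  have powers: "has_zero M"
    if "epic ?F (Gamma_fun M) (C_fun M) (alpha S M)" "C_preserves_powers S M"
    using epic_alpha_imp_fixed[OF that(1)] preserves_powers_imp_fixed_unique[OF that(2)]
    by (rule has_zeroI)
  have zero: "full (PSh S M) (SET S) (Gamma_fun M)"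
    "isomorphism ?F (Gamma_fun M) (C_fun M) (alpha S M)"
    "is_local S M" "C_preserves_powers S M" "adjoint (SET S) (PSh S M) Delta_fun (C_fun M)"
    if "has_zero M"
  proof -
    obtain z where z: "z \<in> carrier M" "\<forall>n\<in>carrier M. z \<otimes>\<^bsub>M\<^esub> n = z \<and> n \<otimes>\<^bsub>M\<^esub> z = z"
      using \<open>has_zero M\<close> unfolding has_zero_def by (rule bexE)
    interpret zero_element M z
      by unfold_locales (simp_all add: z)
    show "full (PSh S M) (SET S) (Gamma_fun M)"
      by (rule full_Gamma[OF assms(1)])
    show "isomorphism ?F (Gamma_fun M) (C_fun M) (alpha S M)"
      by (rule alpha_isomorphism[OF assms(1)])
    show "C_preserves_powers S M"
      by (rule preserves_powers)
    show "adjoint (SET S) (PSh S M) Delta_fun (C_fun M)"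
      by (rule adjoint_Delta_C[OF assms(1)])
    show "is_local S M"
      using adjoint_Gamma_Delta[OF assms(1)] unfolding is_local_def by blast
  qed
  have colocal: "is_colocal S M" if "has_zero M"
    using zero(5)[OF that] unfolding is_colocal_def by blast
  have monic: "monic ?F (Gamma_fun M) (C_fun M) (alpha S M)"
    and epic: "epic ?F (Gamma_fun M) (C_fun M) (alpha S M)" if "has_zero M"
    using isomorphism_imp_monic[OF category_functor_cat[OF category_SET] zero(2)[OF that]]
      isomorphism_imp_epic[OF category_functor_cat[OF category_SET] zero(2)[OF that]] .
  \<comment> \<open>The left adjoint is \<open>Delta_fun\<close>, which sends a singleton to the
    one-point \<open>M\<close>-set.\<close>
  have colocal_point: "\<exists>L. adjoint (SET S) (PSh S M) L (C_fun M) \<and>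
      preserves_terminal (SET S) (PSh S M) L" if "has_zero M"
    using zero(5)[OF that] preserves_terminal_Delta[OF assms(1)] by blast
  show ?thesis
  proof (intro conjI)
    show "has_zero M \<longleftrightarrow> full (PSh S M) (SET S) (Gamma_fun M)"
      using zero(1) full_imp_zero by blast
    show "has_zero M \<longleftrightarrow> split_monic ?F (Gamma_fun M) (C_fun M) (alpha S M)"
      using isomorphism_imp_split_monic[OF zero(2)] split_monic_alpha_imp_zero by blast
    show "has_zero M \<longleftrightarrow> isomorphism ?F (Gamma_fun M) (C_fun M) (alpha S M)"
      using zero(2) split by blast
    show "has_zero M \<longleftrightarrow> bipunctually_locally_connected S M"
      using monic epic bipunctual unfolding bipunctually_locally_connected_def
        punctually_locally_connected_def copunctually_locally_connected_def by blast
    show "has_zero M \<longleftrightarrow> is_bilocal S M"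
      using zero(3) colocal C_monos local_monos unfolding is_bilocal_def by blast
    show "has_zero M \<longleftrightarrow>
        epic ?F (Gamma_fun M) (C_fun M) (alpha S M) \<and> C_preserves_powers S M"
      using epic zero(4) powers by blast
    show "has_zero M \<longleftrightarrow> is_local S M \<and> preserves_monos (PSh S M) (SET S) (C_fun M)"
      using zero(3) colocal C_monos local_monos by blast
    show "has_zero M \<longleftrightarrow> (\<exists>L. adjoint (SET S) (PSh S M) L (C_fun M) \<and>
        preserves_terminal (SET S) (PSh S M) L)"
      using colocal_point left_adjoint_C_imp_zero by blast
  qed
qed

end
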